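(* Let $\mathbb K$ be a unital commutative associative ring containing $\frac16$ and let $P$ be a nonzero Kantor pair over $\mathbb K$. Then: (i) The following are equivalent: (a) $P$ is simple; (b) there exists a simple $5$-graded Lie algebra $L$ that envelops $P$. (ii) If $L$ is a simple $5$-graded Lie algebra that envelops $P$, then there exists a unique $5$-graded isomorphism of $L$ onto the Kantor Lie algebra $\mathfrak K(P)$ (with its standard $5$-grading) that extends the identity map on $T_L(P)=P^-\oplus P^+$. (iii) Statements (a) and (b) in (i), with "simple" replaced by "central simple" in both, are equivalent.
   Context: All modules and algebras are over $\mathbb K$; $\sigma=\pm$ (also read as $\pm1$). Kantor pairs. A trilinear pair is a pair $P=(P^-,P^+)$ of modules with trilinear maps $\{\,,\,,\,\}:P^\sigma\times P^{-\sigma}\times P^\sigma\to P^\sigma$, $\sigma=\pm$. Put $D(x^\sigma,y^{-\sigma})z^\sigma=\{x^\sigma,y^{-\sigma},z^\sigma\}$ and $K(x^\sigma,z^\sigma)y^{-\sigma}=\{x^\sigma,y^{-\sigma},z^\sigma\}-\{z^\sigma,y^{-\sigma},x^\sigma\}$. $P$ is a Kantor pair if for all $x^\sigma,z^\sigma,u^\sigma\in P^\sigma$, $y^{-\sigma},w^{-\sigma}\in P^{-\sigma}$, $\sigma=\pm$: (K1) $[D(x^\sigma,y^{-\sigma}),D(z^\sigma,w^{-\sigma})]=D(D(x^\sigma,y^{-\sigma})z^\sigma,w^{-\sigma})-D(z^\sigma,D(y^{-\sigma},x^\sigma)w^{-\sigma})$; (K2) $K(x^\sigma,z^\sigma)D(w^{-\sigma},u^\sigma)+D(u^\sigma,w^{-\sigma})K(x^\sigma,z^\sigma)=K(K(x^\sigma,z^\sigma)w^{-\sigma},u^\sigma)$.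 An ideal of $P$ is a pair $Q=(Q^-,Q^+)$ of submodules with $\{P^\sigma,P^{-\sigma},Q^\sigma\}+\{P^\sigma,Q^{-\sigma},P^\sigma\}+\{Q^\sigma,P^{-\sigma},P^\sigma\}\subseteq Q^\sigma$. $P$ is simple if $\{P^\sigma,P^{-\sigma},P^\sigma\}\neq0$ for some $\sigma$ and its only ideals are $0$ and $P$. The centroid $C(P)$ consists of pairs $(\omega^-,\omega^+)\in\mathrm{End}(P^-)\oplus\mathrm{End}(P^+)$ with $\omega^\sigma\{x^\sigma,y^{-\sigma},z^\sigma\}=\{\omega^\sigma x^\sigma,y^{-\sigma},z^\sigma\}=\{x^\sigma,\omega^{-\sigma}y^{-\sigma},z^\sigma\}=\{x^\sigma,y^{-\sigma},\omega^\sigma z^\sigma\}$; $P$ is central if $a\mapsto a(\mathrm{id}_{P^-},\mathrm{id}_{P^+})$ is an isomorphism $\mathbb K\to C(P)$. Similarly a Lie algebra $L$ is central if $a\mapsto a\,\mathrm{id}_L$ is an isomorphism of $\mathbb K$ onto the centroid of $L$ (endomorphisms commuting with all multiplication operators). Simplicity of graded objects is always in the ungraded sense. Envelopes. A $5$-graded Lie algebra is a $\mathbb Z$-graded Lie algebra $L=\bigoplus_{i}L_i$ with $L_i=0$ for $|i|>2$. Then $(L_{-1},L_1)$ with products $\{x^\sigma,y^{-\sigma},z^\sigma\}=[[x^\sigma,y^{-\sigma}],z^\sigma]$ is a Kantor pair; $L$ envelops $P$ if $P=(L_{-1},L_1)$ as Kantor pairs. Put $T_L(P)=L_{-1}\oplus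 L_1\subseteq L$. Kantor Lie algebra. Identify $\mathrm{End}(P^-\oplus P^+)$ with $2\times2$ matrices of homomorphisms acting on column vectors $\begin{bmatrix} P^- \\ P^+ \end{bmatrix}$. Let $\mathfrak S(P)$ be the span of all $\begin{bmatrix} D(x^-,x^+) & K(y^-,z^-) \\ K(y^+,z^+) & -D(x^+,x^-) \end{bmatrix}$, $x^\sigma,y^\sigma,z^\sigma\in P^\sigma$. $\mathfrak K(P)=\mathfrak S(P)\oplus\begin{bmatrix} P^- \\ P^+ \end{bmatrix}$ is the Lie algebra with $[A,B]=AB-BA$, $[A,v]=Av$ for $A,B\in\mathfrak S(P)$ and column vectors $v$, and $\left[\begin{bmatrix} x^- \\ x^+ \end{bmatrix},\begin{bmatrix} y^- \\ y^+ \end{bmatrix}\right]=\begin{bmatrix} D(x^-,y^+)-D(y^-,x^+) & K(x^-,y^-) \\ K(x^+,y^+) & -D(y^+,x^-)+D(x^+,y^-) \end{bmatrix}$. Its standard $5$-grading has $\mathfrak K(P)_{-1}=\begin{bmatrix} P^- \\ 0 \end{bmatrix}$, $\mathfrak K(P)_1=\begin{bmatrix} 0 \\ P^+ \end{bmatrix}$, $\mathfrak K(P)_{-2}$ (resp. $\mathfrak K(P)_2$) the strictly upper (resp. strictly lower) triangular part of $\mathfrak S(P)$, and $\mathfrak K(P)_0$ the span of the matrices $\mathrm{diag}(D(x^-,x^+),-D(x^+,x^-))$. $P^\pm$ is identified with $\mathfrak K(P)_{\pm1}$. *)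

theory Defs
  imports
    Complex_Main
    "HOL-Library.FuncSet"
    "HOL-Library.Function_Algebras"
    "HOL-Library.Product_Plus"
begin

section \<open>Kantor pairs\<close>

text \<open>
  The scalars form a type of class \<^class>\<open>comm_ring_1\<close>. The two modules of a pair occupy whole
  types \<open>'m\<close> (for $P^-$) and \<open>'p\<close> (for $P^+$). Notions that are required for both signs are
  stated once, for a product \<open>f :: 'a \<Rightarrow> 'b \<Rightarrow> 'a \<Rightarrow> 'a\<close> and its partner
  \<open>g :: 'b \<Rightarrow> 'a \<Rightarrow> 'b \<Rightarrow> 'b\<close>, and then used for both orders of the two products.
\<close>

record ('k, 'm, 'p) pair =
  smult_minus :: "'k \<Rightarrow> 'm \<Rightarrow> 'm"
  smult_plus :: "'k \<Rightarrow> 'p \<Rightarrow> 'p"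
  triple_minus :: "'m \<Rightarrow> 'p \<Rightarrow> 'm \<Rightarrow> 'm"
  triple_plus :: "'p \<Rightarrow> 'm \<Rightarrow> 'p \<Rightarrow> 'p"

definition trilinear ::
    "('k::comm_ring_1 \<Rightarrow> 'a::ab_group_add \<Rightarrow> 'a) \<Rightarrow> ('k \<Rightarrow> 'b::ab_group_add \<Rightarrow> 'b)
      \<Rightarrow> ('a \<Rightarrow> 'b \<Rightarrow> 'a \<Rightarrow> 'a) \<Rightarrow> bool" where
  "trilinear s t f \<longleftrightarrow>
     (\<forall>y z. module_hom s s (\<lambda>x. f x y z)) \<and>
     (\<forall>x z. module_hom t s (\<lambda>y. f x y z)) \<and>
     (\<forall>x y. module_hom s s (\<lambda>z. f x y z))"

definition trilinear_pair ::
    "('k::comm_ring_1, 'm::ab_group_add, 'p::ab_group_add) pair \<Rightarrow> bool" where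
  "trilinear_pair P \<longleftrightarrow>
     module (smult_minus P) \<and> module (smult_plus P) \<and>
     trilinear (smult_minus P) (smult_plus P) (triple_minus P) \<and>
     trilinear (smult_plus P) (smult_minus P) (triple_plus P)"

definition D_op :: "('a \<Rightarrow> 'b \<Rightarrow> 'a \<Rightarrow> 'a) \<Rightarrow> 'a \<Rightarrow> 'b \<Rightarrow> 'a \<Rightarrow> 'a" where
  "D_op f x y = (\<lambda>z. f x y z)"

definition K_op :: "('a \<Rightarrow> 'b \<Rightarrow> 'a \<Rightarrow> 'a::ab_group_add) \<Rightarrow> 'a \<Rightarrow> 'a \<Rightarrow> 'b \<Rightarrow> 'a" where
  "K_op f x z = (\<lambda>y. f x y z - f z y x)"

definition K1_identity ::
    "('a \<Rightarrow> 'b \<Rightarrow> 'a \<Rightarrow> 'a::ab_group_add) \<Rightarrow> ('b \<Rightarrow> 'a \<Rightarrow> 'b \<Rightarrow> 'b::ab_group_add) \<Rightarrow> bool" where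
  "K1_identity f g \<longleftrightarrow> (\<forall>x y z w.
     (D_op f x y \<circ> D_op f z w) - (D_op f z w \<circ> D_op f x y)
       = D_op f (D_op f x y z) w - D_op f z (D_op g y x w))"

definition K2_identity ::
    "('a \<Rightarrow> 'b \<Rightarrow> 'a \<Rightarrow> 'a::ab_group_add) \<Rightarrow> ('b \<Rightarrow> 'a \<Rightarrow> 'b \<Rightarrow> 'b::ab_group_add) \<Rightarrow> bool" where
  "K2_identity f g \<longleftrightarrow> (\<forall>x z w u.
     (K_op f x z \<circ> D_op g w u) + (D_op f u w \<circ> K_op f x z)
       = K_op f (K_op f x z w) u)"

definition kantor_pair ::
    "('k::comm_ring_1, 'm::ab_group_add, 'p::ab_group_add) pair \<Rightarrow> bool" where
  "kantor_pair P \<longleftrightarrow>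
     trilinear_pair P \<and>
     K1_identity (triple_minus P) (triple_plus P) \<and> K1_identity (triple_plus P) (triple_minus P) \<and>
     K2_identity (triple_minus P) (triple_plus P) \<and> K2_identity (triple_plus P) (triple_minus P)"

definition nonzero_pair ::
    "('k::comm_ring_1, 'm::ab_group_add, 'p::ab_group_add) pair \<Rightarrow> bool" where
  "nonzero_pair P \<longleftrightarrow> (\<exists>x::'m. x \<noteq> 0) \<or> (\<exists>x::'p. x \<noteq> 0)"

definition absorbs :: "('a \<Rightarrow> 'b \<Rightarrow> 'a \<Rightarrow> 'a) \<Rightarrow> 'a set \<Rightarrow> 'b set \<Rightarrow> bool" where
  "absorbs f Q R \<longleftrightarrow>
     (\<forall>x y. \<forall>z\<in>Q. f x y z \<in> Q) \<and>
     (\<forall>x z. \<forall>y\<in>R. f x y z \<in> Q) \<and>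
     (\<forall>y z. \<forall>x\<in>Q. f x y z \<in> Q)"

definition pair_ideal ::
    "('k::comm_ring_1, 'm::ab_group_add, 'p::ab_group_add) pair \<Rightarrow> 'm set \<Rightarrow> 'p set \<Rightarrow> bool" where
  "pair_ideal P Qm Qp \<longleftrightarrow>
     module.subspace (smult_minus P) Qm \<and> module.subspace (smult_plus P) Qp \<and>
     absorbs (triple_minus P) Qm Qp \<and> absorbs (triple_plus P) Qp Qm"

definition simple_pair ::
    "('k::comm_ring_1, 'm::ab_group_add, 'p::ab_group_add) pair \<Rightarrow> bool" where
  "simple_pair P \<longleftrightarrow>
     ((\<exists>x y z. triple_minus P x y z \<noteq> 0) \<or> (\<exists>x y z. triple_plus P x y z \<noteq> 0)) \<and>
     (\<forall>Qm Qp. pair_ideal P Qm Qp \<longrightarrow> (Qm = {0} \<and> Qp = {0}) \<or> (Qm = UNIV \<and> Qp = UNIV))"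

definition centralizes :: "('a \<Rightarrow> 'b \<Rightarrow> 'a \<Rightarrow> 'a) \<Rightarrow> ('a \<Rightarrow> 'a) \<Rightarrow> ('b \<Rightarrow> 'b) \<Rightarrow> bool" where
  "centralizes f \<omega> \<omega>' \<longleftrightarrow> (\<forall>x y z.
     \<omega> (f x y z) = f (\<omega> x) y z \<and>
     \<omega> (f x y z) = f x (\<omega>' y) z \<and>
     \<omega> (f x y z) = f x y (\<omega> z))"

definition pair_centroid ::
    "('k::comm_ring_1, 'm::ab_group_add, 'p::ab_group_add) pair \<Rightarrow> (('m \<Rightarrow> 'm) \<times> ('p \<Rightarrow> 'p)) set" where
  "pair_centroid P = {(\<omega>m, \<omega>p).
     module_hom (smult_minus P) (smult_minus P) \<omega>m \<and>
     module_hom (smult_plus P) (smult_plus P) \<omega>p \<and>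
     centralizes (triple_minus P) \<omega>m \<omega>p \<and>
     centralizes (triple_plus P) \<omega>p \<omega>m}"

text \<open>
  The map $a \mapsto a(\mathrm{id}, \mathrm{id})$ is always a homomorphism of algebras, so it is an
  isomorphism onto the centroid iff it is bijective. The same applies to \<open>central_lie\<close> below.
\<close>

definition central_pair ::
    "('k::comm_ring_1, 'm::ab_group_add, 'p::ab_group_add) pair \<Rightarrow> bool" where
  "central_pair P \<longleftrightarrow>
     bij_betw (\<lambda>a. (\<lambda>x. smult_minus P a x, \<lambda>x. smult_plus P a x)) UNIV (pair_centroid P)"


section \<open>Graded Lie algebras\<close>

text \<open>
  A Lie algebra is carried by a submodule \<open>carrier L\<close> of a module that occupies the type \<open>'l\<close>;
  it may be the whole type. Outside the carrier the bracket is irrelevant.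
\<close>

record ('k, 'l) graded_lie =
  carrier :: "'l set"
  smult :: "'k \<Rightarrow> 'l \<Rightarrow> 'l"
  bracket :: "'l \<Rightarrow> 'l \<Rightarrow> 'l"
  grade :: "int \<Rightarrow> 'l set"

definition linear_between ::
    "('k::comm_ring_1 \<Rightarrow> 'a::ab_group_add \<Rightarrow> 'a) \<Rightarrow> 'a set \<Rightarrow> ('k \<Rightarrow> 'b::ab_group_add \<Rightarrow> 'b) \<Rightarrow> 'b set
      \<Rightarrow> ('a \<Rightarrow> 'b) \<Rightarrow> bool" where
  "linear_between s V t W f \<longleftrightarrow>
     f \<in> V \<rightarrow> W \<and>
     (\<forall>x\<in>V. \<forall>y\<in>V. f (x + y) = f x + f y) \<and>
     (\<forall>a. \<forall>x\<in>V. f (s a x) = t a (f x))"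

definition lie_algebra :: "('k::comm_ring_1, 'l::ab_group_add, 'r) graded_lie_scheme \<Rightarrow> bool" where
  "lie_algebra L \<longleftrightarrow>
     module (smult L) \<and> module.subspace (smult L) (carrier L) \<and>
     (\<forall>x\<in>carrier L. linear_between (smult L) (carrier L) (smult L) (carrier L) (\<lambda>y. bracket L x y)) \<and>
     (\<forall>y\<in>carrier L. linear_between (smult L) (carrier L) (smult L) (carrier L) (\<lambda>x. bracket L x y)) \<and>
     (\<forall>x\<in>carrier L. bracket L x x = 0) \<and>
     (\<forall>x\<in>carrier L. \<forall>y\<in>carrier L. \<forall>z\<in>carrier L.
        bracket L x (bracket L y z) + bracket L y (bracket L z x) + bracket L z (bracket L x y) = 0)"

definition graded_lie_algebra ::
    "('k::comm_ring_1, 'l::ab_group_add, 'r) graded_lie_scheme \<Rightarrow> bool" where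
  "graded_lie_algebra L \<longleftrightarrow>
     lie_algebra L \<and>
     (\<forall>i. module.subspace (smult L) (grade L i) \<and> grade L i \<subseteq> carrier L) \<and>
     (\<forall>x\<in>carrier L. \<exists>!c. (\<forall>i. c i \<in> grade L i) \<and> finite {i. c i \<noteq> 0} \<and> x = (\<Sum>i | c i \<noteq> 0. c i)) \<and>
     (\<forall>i j. \<forall>x\<in>grade L i. \<forall>y\<in>grade L j. bracket L x y \<in> grade L (i + j))"

definition five_graded_lie_algebra ::
    "('k::comm_ring_1, 'l::ab_group_add, 'r) graded_lie_scheme \<Rightarrow> bool" where
  "five_graded_lie_algebra L \<longleftrightarrow>
     graded_lie_algebra L \<and> (\<forall>i. \<bar>i\<bar> > 2 \<longrightarrow> grade L i = {0})"

definition lie_ideal :: "('k::comm_ring_1, 'l::ab_group_add, 'r) graded_lie_scheme \<Rightarrow> 'l set \<Rightarrow> bool" where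
  "lie_ideal L I \<longleftrightarrow>
     module.subspace (smult L) I \<and> I \<subseteq> carrier L \<and>
     (\<forall>x\<in>carrier L. \<forall>y\<in>I. bracket L x y \<in> I)"

definition simple_lie :: "('k::comm_ring_1, 'l::ab_group_add, 'r) graded_lie_scheme \<Rightarrow> bool" where
  "simple_lie L \<longleftrightarrow>
     (\<exists>x\<in>carrier L. \<exists>y\<in>carrier L. bracket L x y \<noteq> 0) \<and>
     (\<forall>I. lie_ideal L I \<longrightarrow> I = {0} \<or> I = carrier L)"

text \<open>
  Endomorphisms of \<open>carrier L\<close> are represented by functions that are undefined outside of it.
\<close>

definition lie_centroid ::
    "('k::comm_ring_1, 'l::ab_group_add, 'r) graded_lie_scheme \<Rightarrow> ('l \<Rightarrow> 'l) set" where
  "lie_centroid L = {f \<in> extensional (carrier L).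
     linear_between (smult L) (carrier L) (smult L) (carrier L) f \<and>
     (\<forall>x\<in>carrier L. \<forall>y\<in>carrier L.
        f (bracket L x y) = bracket L x (f y) \<and> f (bracket L x y) = bracket L (f x) y)}"

definition central_lie :: "('k::comm_ring_1, 'l::ab_group_add, 'r) graded_lie_scheme \<Rightarrow> bool" where
  "central_lie L \<longleftrightarrow> bij_betw (\<lambda>a. \<lambda>x\<in>carrier L. smult L a x) UNIV (lie_centroid L)"

definition graded_isomorphism ::
    "('k::comm_ring_1, 'l::ab_group_add, 'r) graded_lie_scheme
      \<Rightarrow> ('k, 'n::ab_group_add, 's) graded_lie_scheme \<Rightarrow> ('l \<Rightarrow> 'n) \<Rightarrow> bool" where
  "graded_isomorphism L M \<phi> \<longleftrightarrow>
     bij_betw \<phi> (carrier L) (carrier M) \<and>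
     linear_between (smult L) (carrier L) (smult M) (carrier M) \<phi> \<and>
     (\<forall>x\<in>carrier L. \<forall>y\<in>carrier L. \<phi> (bracket L x y) = bracket M (\<phi> x) (\<phi> y)) \<and>
     (\<forall>i. \<phi> ` grade L i = grade M i)"

text \<open>
  The equality $P = (L_{-1}, L_1)$ of Kantor pairs is an identification; it is made explicit as a
  pair of module isomorphisms \<open>em\<close> from $P^-$ onto $L_{-1}$ and \<open>ep\<close> from $P^+$ onto $L_1$ that
  carry the products of the pair to $[[x, y], z]$.
\<close>

definition envelops ::
    "('k::comm_ring_1, 'l::ab_group_add, 'r) graded_lie_scheme
      \<Rightarrow> ('k, 'm::ab_group_add, 'p::ab_group_add) pair \<Rightarrow> ('m \<Rightarrow> 'l) \<Rightarrow> ('p \<Rightarrow> 'l) \<Rightarrow> bool" where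
  "envelops L P em ep \<longleftrightarrow>
     module_hom (smult_minus P) (smult L) em \<and> bij_betw em UNIV (grade L (-1)) \<and>
     module_hom (smult_plus P) (smult L) ep \<and> bij_betw ep UNIV (grade L 1) \<and>
     (\<forall>x y z. em (triple_minus P x y z) = bracket L (bracket L (em x) (ep y)) (em z)) \<and>
     (\<forall>x y z. ep (triple_plus P x y z) = bracket L (bracket L (ep x) (em y)) (ep z))"


section \<open>The Kantor Lie algebra of a Kantor pair\<close>

text \<open>
  A column vector is a pair, and a matrix is the map that it induces on column vectors; sums and
  differences of matrices are pointwise. The algebra is carried by a submodule of the type of pairs
  consisting of a map on column vectors and a column vector.
\<close>

type_synonym ('m, 'p) kantor_space = "('m \<times> 'p \<Rightarrow> 'm \<times> 'p) \<times> ('m \<times> 'p)"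

definition mat2 ::
    "('m \<Rightarrow> 'm::ab_group_add) \<Rightarrow> ('p \<Rightarrow> 'm) \<Rightarrow> ('m \<Rightarrow> 'p) \<Rightarrow> ('p \<Rightarrow> 'p::ab_group_add)
      \<Rightarrow> 'm \<times> 'p \<Rightarrow> 'm \<times> 'p" where
  "mat2 A B C E = (\<lambda>(u, v). (A u + B v, C u + E v))"

definition smult_column ::
    "('k, 'm, 'p) pair \<Rightarrow> 'k \<Rightarrow> 'm \<times> 'p \<Rightarrow> 'm \<times> 'p" where
  "smult_column P a = (\<lambda>(u, v). (smult_minus P a u, smult_plus P a v))"

definition smult_matrix ::
    "('k, 'm, 'p) pair \<Rightarrow> 'k \<Rightarrow> ('m \<times> 'p \<Rightarrow> 'm \<times> 'p) \<Rightarrow> 'm \<times> 'p \<Rightarrow> 'm \<times> 'p" where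
  "smult_matrix P a A = (\<lambda>v. smult_column P a (A v))"

definition kantor_S ::
    "('k::comm_ring_1, 'm::ab_group_add, 'p::ab_group_add) pair \<Rightarrow> ('m \<times> 'p \<Rightarrow> 'm \<times> 'p) set" where
  "kantor_S P = module.span (smult_matrix P)
     {mat2 (D_op (triple_minus P) xm xp) (K_op (triple_minus P) ym zm)
           (K_op (triple_plus P) yp zp) (- D_op (triple_plus P) xp xm) | xm xp ym zm yp zp. True}"

definition kantor_S0 ::
    "('k::comm_ring_1, 'm::ab_group_add, 'p::ab_group_add) pair \<Rightarrow> ('m \<times> 'p \<Rightarrow> 'm \<times> 'p) set" where
  "kantor_S0 P = module.span (smult_matrix P)
     {mat2 (D_op (triple_minus P) xm xp) 0 0 (- D_op (triple_plus P) xp xm) | xm xp. True}"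

definition column_bracket ::
    "('k, 'm::ab_group_add, 'p::ab_group_add) pair \<Rightarrow> 'm \<times> 'p \<Rightarrow> 'm \<times> 'p \<Rightarrow> 'm \<times> 'p \<Rightarrow> 'm \<times> 'p" where
  "column_bracket P = (\<lambda>(xm, xp) (ym, yp).
     mat2 (D_op (triple_minus P) xm yp - D_op (triple_minus P) ym xp)
          (K_op (triple_minus P) xm ym)
          (K_op (triple_plus P) xp yp)
          (- D_op (triple_plus P) yp xm + D_op (triple_plus P) xp ym))"

definition kantor_lie ::
    "('k::comm_ring_1, 'm::ab_group_add, 'p::ab_group_add) pair
      \<Rightarrow> ('k, ('m, 'p) kantor_space) graded_lie" where
  "kantor_lie P = \<lparr>
     carrier = kantor_S P \<times> UNIV,
     smult = (\<lambda>a (A, v). (smult_matrix P a A, smult_column P a v)),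
     bracket = (\<lambda>(A, v) (B, w). ((A \<circ> B) - (B \<circ> A) + column_bracket P v w, A w - B v)),
     grade = (\<lambda>i.
       if i = -2 then {A \<in> kantor_S P. \<exists>B. A = mat2 0 B 0 0} \<times> {0}
       else if i = -1 then {0} \<times> (UNIV \<times> {0})
       else if i = 0 then kantor_S0 P \<times> {0}
       else if i = 1 then {0} \<times> ({0} \<times> UNIV)
       else if i = 2 then {A \<in> kantor_S P. \<exists>C. A = mat2 0 0 C 0} \<times> {0}
       else {0})\<rparr>"

definition kantor_minus :: "'m::ab_group_add \<Rightarrow> ('m, 'p::ab_group_add) kantor_space" where
  "kantor_minus x = (0, (x, 0))"

definition kantor_plus :: "'p::ab_group_add \<Rightarrow> ('m::ab_group_add, 'p) kantor_space" where
  "kantor_plus x = (0, (0, x))"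

end

theory Submission
  imports Defs
begin

text \<open>
  Write $T = L_{-1} \oplus L_1$ for a $5$-graded Lie algebra $L$ that envelops $P$. If $L$ is simple and
  $P \neq 0$, then the ideal $[T, T] + T$ is all of $L$ and the ideal
  $\{x \in L_{-2} + L_0 + L_2 \mid [x, T] = 0\}$ vanishes. Hence the even part of $L$ is spanned by
  $[T, T]$ and acts faithfully on $T$, by matrices which (K1) and (K2) determine; this yields the
  isomorphism with $\mathfrak K(P)$. Conversely, $\mathfrak K(P)$ has these two properties for every
  Kantor pair.

  For any $L$ with these two properties, an ideal $Q$ of $P$ generates the ideal $Q + [T, Q]$ of $L$,
  which meets $T$ in $Q$. An ungraded ideal $I$ of $L$ is controlled by its initial forms:
  the lowest components of degree $\pm 1$ of elements of $I$ form an ideal of $P$. If this ideal is $0$,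
  then faithfulness forces $I = 0$, and if it is $P$, then $I = L$ by descending through the degrees.
  Finally the centroid of a simple $L$ preserves degrees, and restriction to $T$ identifies it
  with $C(P)$.
\<close>

section \<open>Consequences of (K1) and (K2)\<close>

text \<open>Column vectors merge the sign-by-sign identities of a Kantor pair into one structure:
  with the product [[x,y],z] the sum P^- + P^+ becomes a Lie triple system, S(P) is its algebra of
  inner derivations, and K(P) is its standard embedding. Accordingly L is used mainly through its
  Z/2-grading by parity, whose odd part is T. The triple product on T can be computed inside P. In a
  tight envelope a homomorphism is therefore fixed by its values on T, and an even element by its
  action on T. The integer degrees matter where parity is too coarse. An ideal of L need not contain
  the homogeneous components of its elements, so a subpair has to be extracted from lowest terms. An
  element of the centroid has to preserve L_{-1} and L_1 separately before it restricts to a pair of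
  maps; this is where simplicity of L enters the treatment of the centroid. Both the given simple L
  and K(P) are instances of \<open>tight_enveloping\<close>, so each transfer between algebra and
  pair is proved only once.\<close>

locale kantor_identities =
  fixes f :: "'a::ab_group_add \<Rightarrow> 'b::ab_group_add \<Rightarrow> 'a \<Rightarrow> 'a"
    and g :: "'b \<Rightarrow> 'a \<Rightarrow> 'b \<Rightarrow> 'b"
  assumes add1: "f (x + x') y z = f x y z + f x' y z"
    and add2: "f x (y + y') z = f x y z + f x y' z"
    and add3: "f x y (z + z') = f x y z + f x y z'"
    and K1: "K1_identity f g"
    and K2: "K2_identity f g"
begin

lemma diff1: "f (x - x') y z = f x y z - f x' y z"
  using add1[of "x - x'" x' y z] by (simp add: algebra_simps)

lemma diff2: "f x (y - y') z = f x y z - f x y' z"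
  using add2[of x "y - y'" y' z] by (simp add: algebra_simps)

lemma diff3: "f x y (z - z') = f x y z - f x y z'"
  using add3[of x y "z - z'" z'] by (simp add: algebra_simps)

lemma K1_elem: "f x y (f z w u) - f z w (f x y u) = f (f x y z) w u - f z (g y x w) u"
proof -
  have "((D_op f x y \<circ> D_op f z w) - (D_op f z w \<circ> D_op f x y)) u
       = (D_op f (D_op f x y z) w - D_op f z (D_op g y x w)) u"
    using K1 by (simp add: K1_identity_def)
  then show ?thesis by (simp add: D_op_def)
qed

lemma K2_elem: "K_op f x z (g w u v) + f u w (K_op f x z v) = K_op f (K_op f x z w) u v"
proof -
  have "((K_op f x z \<circ> D_op g w u) + (D_op f u w \<circ> K_op f x z)) v = K_op f (K_op f x z w) u v"
    using K2 by (simp add: K2_identity_def)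
  then show ?thesis by (simp add: D_op_def)
qed

lemma K_diff: "K_op f x z (y - y') = K_op f x z y - K_op f x z y'"
  by (simp add: K_op_def diff2)

text \<open>Antisymmetrising (K1) in v and w gives this: D(a,b), acting as -D(b,a) on the opposite
  side, is a derivation with respect to K.\<close>

lemma D_K: "f a b (K_op f v w c) + K_op f v w (g b a c) = K_op f (f a b v) w c + K_op f v (f a b w) c"
  using K1_elem[of a b v c w] K1_elem[of a b w c v]
  by (simp add: K_op_def diff3 algebra_simps)

text \<open>Expanding the right side of (K2) leaves, besides f (K(a,b)w) v u, only terms symmetric
  in v and w. They cancel on antisymmetrising.\<close>

lemma K_K: "K_op f a b (K_op g v w u) = f (K_op f a b v) w u - f (K_op f a b w) v u"
proof -
  have *: "K_op f a b (g w u v) = f (K_op f a b w) v u - f u v (K_op f a b w) - f u w (K_op f a b v)"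
    for v w u
    using K2_elem[of a b w u v] unfolding K_op_def[of f "K_op f a b w"] by (metis add_diff_cancel_right')
  show ?thesis
    unfolding K_op_def[of g] K_diff *[of v u w] *[of w u v] by (simp only: algebra_simps)
qed

text \<open>The commutators of D(v,a) with D(w,b) and of D(w,b) with D(v,a) sum to zero. Writing
  both by (K1) and antisymmetrising the result in v and w yields the exchange rule.\<close>

lemma D_K_exchange: "f (K_op f v w a) b u - f (K_op f v w b) a u
    = f w (K_op g a b v) u - f v (K_op g a b w) u"
proof -
  have 1: "f (f v a w) b u - f w (g a v b) u + f (f w b v) a u - f v (g b w a) u = 0" for v w
    using arg_cong2[OF K1_elem[of v a w b u] K1_elem[of w b v a u], of "(+)"] by (simp add: algebra_simps)
  show ?thesis using arg_cong2[OF 1[of v w] 1[of w v], of "(-)"]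
    by (simp add: K_op_def diff1 diff2 algebra_simps)
qed

text \<open>The commutator of an upper and a lower triangular matrix has two diagonal blocks.
  \<open>K_K\<close> computes one of them and this form the other.\<close>

lemma K_K': "K_op f v w (K_op g a b u) = f w (K_op g a b v) u - f v (K_op g a b w) u"
  by (simp add: K_K D_K_exchange)

end

section \<open>Columns as a Lie triple system\<close>

locale kantor_pair_loc =
  fixes P :: "('k::comm_ring_1, 'm::ab_group_add, 'p::ab_group_add) pair"
  assumes kantor: "kantor_pair P"
begin

abbreviation sm where "sm \<equiv> smult_minus P"
abbreviation sp where "sp \<equiv> smult_plus P"
abbreviation tm where "tm \<equiv> triple_minus P"
abbreviation tp where "tp \<equiv> triple_plus P"
abbreviation cb where "cb \<equiv> column_bracket P"

lemma module_sm: "module sm" and module_sp: "module sp"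
  and trilinear_tm: "trilinear sm sp tm" and trilinear_tp: "trilinear sp sm tp"
  using kantor by (auto simp: kantor_pair_def trilinear_pair_def)

sublocale M: module sm by (rule module_sm)
sublocale Q: module sp by (rule module_sp)

lemma tm_hom: "module_hom sm sm (\<lambda>x. tm x y z)" "module_hom sp sm (\<lambda>y. tm x y z)"
    "module_hom sm sm (\<lambda>z. tm x y z)"
  and tp_hom: "module_hom sp sp (\<lambda>x. tp x y' z')" "module_hom sm sp (\<lambda>y. tp x' y z')"
    "module_hom sp sp (\<lambda>z. tp x' y' z)"
  using trilinear_tm trilinear_tp by (auto simp: trilinear_def)

lemmas tm_simps =
  tm_hom[THEN module_hom.add] tm_hom[THEN module_hom.diff] tm_hom[THEN module_hom.neg]
  tm_hom[THEN module_hom.zero] tm_hom[THEN module_hom.scale]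
lemmas tp_simps =
  tp_hom[THEN module_hom.add] tp_hom[THEN module_hom.diff] tp_hom[THEN module_hom.neg]
  tp_hom[THEN module_hom.zero] tp_hom[THEN module_hom.scale]

text \<open>Interpreting the identities for both orders of the two products gives each of them for
  both signs.\<close>

sublocale I: kantor_identities tm tp
  by unfold_locales (use kantor in \<open>auto simp: tm_simps kantor_pair_def\<close>)
sublocale J: kantor_identities tp tm
  by unfold_locales (use kantor in \<open>auto simp: tp_simps kantor_pair_def\<close>)

lemma sc_simps: "sm a (x + x') = sm a x + sm a x'" "sm a (x - x') = sm a x - sm a x'" "sm a (- x) = - sm a x"
  "sp a (y + y') = sp a y + sp a y'" "sp a (y - y') = sp a y - sp a y'" "sp a (- y) = - sp a y"
  by (simp_all add: M.scale_right_distrib M.scale_right_diff_distrib Q.scale_right_distrib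
    Q.scale_right_diff_distrib)

text \<open>Read as a trilinear product on columns, \<open>cb\<close> models [[x,y],z]. The axioms
  of a Lie triple system are \<open>cb_same\<close>, \<open>cb_jacobi\<close> and
  \<open>cb_derivation\<close>.\<close>

lemma cb_eq: "cb x y z =
    (tm (fst x) (snd y) (fst z) - tm (fst y) (snd x) (fst z)
       + (tm (fst x) (snd z) (fst y) - tm (fst y) (snd z) (fst x)),
     tp (snd x) (fst z) (snd y) - tp (snd y) (fst z) (snd x)
       + (tp (snd x) (fst y) (snd z) - tp (snd y) (fst x) (snd z)))"
  by (cases x; cases y; cases z) (simp add: column_bracket_def mat2_def D_op_def K_op_def)

lemma cb_add: "cb (x + x') y z = cb x y z + cb x' y z" "cb x (y + y') z = cb x y z + cb x y' z"
  "cb x y (z + z') = cb x y z + cb x y z'"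
  by (simp_all add: cb_eq prod_eq_iff tm_simps tp_simps algebra_simps)

lemma cb_scale: "cb (smult_column P a x) y z = smult_column P a (cb x y z)"
  "cb x (smult_column P a y) z = smult_column P a (cb x y z)"
  "cb x y (smult_column P a z) = smult_column P a (cb x y z)"
  by (simp_all add: cb_eq smult_column_def split_beta prod_eq_iff tm_simps tp_simps sc_simps algebra_simps)

lemma cb_minus: "cb (- x) y z = - cb x y z" "cb x (- y) z = - cb x y z"  "cb x y (- z) = - cb x y z"
  by (simp_all add: cb_eq prod_eq_iff tm_simps tp_simps algebra_simps)

lemma cb_diff: "cb (x - x') y z = cb x y z - cb x' y z" "cb x (y - y') z = cb x y z - cb x y' z"
  "cb x y (z - z') = cb x y z - cb x y z'"
  by (simp_all add: cb_eq prod_eq_iff tm_simps tp_simps algebra_simps)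

lemma cb_zero [simp]: "cb 0 y z = 0" "cb x 0 z = 0" "cb x y 0 = 0"
  by (simp_all add: cb_eq prod_eq_iff tm_simps tp_simps)

lemma cb_anti: "cb x y z = - cb y x z"
  by (simp add: cb_eq prod_eq_iff algebra_simps)

lemma cb_same [simp]: "cb x x = 0"
  by (rule ext) (simp add: cb_eq prod_eq_iff)

lemma cb_jacobi: "cb x y z + cb y z x + cb z x y = 0"
  by (simp add: cb_eq prod_eq_iff)

lemma cb_homogeneous:
  "cb (x, 0) (0, y) z = (tm x y (fst z), - tp y x (snd z))"
  "cb (x, 0) (x', 0) z = (K_op tm x x' (snd z), 0)"
  "cb (0, y) (0, y') z = (0, K_op tp y y' (fst z))"
  "cb (0, y) (x, 0) z = (- tm x y (fst z), tp y x (snd z))"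
  by (simp_all add: cb_eq K_op_def tm_simps tp_simps)

lemma K_op_anti: "K_op tm x z y = - K_op tm z x y" "K_op tp x' z' y' = - K_op tp z' x' y'"
  by (simp_all add: K_op_def)

lemma K_op_simps [simp]: "K_op tm x z 0 = 0" "K_op tp x' z' 0 = 0"
  "K_op tm x 0 y = 0" "K_op tp x' 0 y' = 0"
  "K_op tm x z (- y) = - K_op tm x z y" "K_op tp x' z' (- y') = - K_op tp x' z' y'"
  by (simp_all add: K_op_def tm_simps tp_simps)

lemma column_split: "x = (fst x, 0::'p) + (0::'m, snd x)"
  by (simp add: prod_eq_iff)

text \<open>By multilinearity and skew-symmetry it suffices to consider homogeneous columns.\<close>

lemma cb_derivation: "cb a b (cb v w c) - cb v w (cb a b c) = cb (cb a b v) w c + cb v (cb a b w) c"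
proof -
  define R where "R a b v w \<longleftrightarrow>
    (\<forall>c. cb a b (cb v w c) - cb v w (cb a b c) = cb (cb a b v) w c + cb v (cb a b w) c)" for a b v w
  have R_add1: "R (a + a') b v w" if "R a b v w" "R a' b v w" for a a' b v w
    unfolding R_def
  proof
    fix c
    from arg_cong2[OF that[unfolded R_def, THEN spec[of _ c]], of "(+)"]
    show "cb (a + a') b (cb v w c) - cb v w (cb (a + a') b c) = cb (cb (a + a') b v) w c + cb v (cb (a + a') b w) c"
      by (simp add: cb_add algebra_simps)
  qed
  have R_add3: "R a b (v + v') w" if "R a b v w" "R a b v' w" for a b v v' w
    unfolding R_def
  proof
    fix c
    from arg_cong2[OF that[unfolded R_def, THEN spec[of _ c]], of "(+)"]
    show "cb a b (cb (v + v') w c) - cb (v + v') w (cb a b c) = cb (cb a b (v + v')) w c + cb (v + v') (cb a b w) c"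
      by (simp add: cb_add algebra_simps)
  qed
  have R_swap1: "R a b v w" if "R b a v w" for a b v w
    unfolding R_def
  proof
    fix c
    note anti = cb_anti[of a b]
    from that[unfolded R_def, THEN spec[of _ c], THEN arg_cong[of _ _ uminus]]
    show "cb a b (cb v w c) - cb v w (cb a b c) = cb (cb a b v) w c + cb v (cb a b w) c"
      unfolding anti cb_minus by (simp only: minus_diff_eq minus_add_distrib) (simp add: algebra_simps)
  qed
  have R_swap3: "R a b v w" if "R a b w v" for a b v w
    unfolding R_def
  proof
    fix c
    note anti = cb_anti[of v w] cb_anti[of "cb a b v" w] cb_anti[of v "cb a b w"]
    from that[unfolded R_def, THEN spec[of _ c], THEN arg_cong[of _ _ uminus]]
    show "cb a b (cb v w c) - cb v w (cb a b c) = cb (cb a b v) w c + cb v (cb a b w) c"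
      unfolding anti cb_minus by (simp only: minus_diff_eq minus_add_distrib) (simp add: algebra_simps)
  qed
  note hom = R_def cb_homogeneous tm_simps tp_simps
  \<comment> \<open>Each of the pairs (a,b) and (v,w) has type mp, mm or pp. The case mp_mp is (K1)
    in both components; mp against mm or pp is \<open>D_K\<close>; mm or pp against mp is (K2); mm
    against pp needs \<open>K_K\<close> and \<open>K_K'\<close>. For equal types mm_mm and pp_pp
    every term vanishes.\<close>
  have mp_mp: "R (a, 0) (0, b) (v, 0) (0, w)" for a b v w
    using I.K1_elem[of a b v w] J.K1_elem[of b a w v] by (simp add: hom)
  have mp_mm: "R (a, 0) (0, b) (v, 0) (v', 0)" for a b v v'
    using I.D_K[of a b v v'] by (simp add: hom)
  have mp_pp: "R (a, 0) (0, b) (0, w) (0, w')" for a b w w'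
    using J.D_K[of b a w w', THEN arg_cong, of uminus] by (simp add: hom K_op_def algebra_simps)
  have mm_mp: "R (a, 0) (a', 0) (v, 0) (0, w)" for a a' v w
    using I.K2_elem[of a a' w v, THEN arg_cong, of uminus] by (simp add: hom K_op_anti(1)[of v])
  have mm_mm: "R (a, 0) (a', 0) (v, 0) (v', 0)" for a a' v v'
    by (simp add: hom zero_prod_def[symmetric])
  have mm_pp: "R (a, 0) (a', 0) (0, w) (0, w')" for a a' w w'
    using I.K_K[of a a' w w'] J.K_K'[of w w' a a'] by (simp add: hom)
  have pp_mp: "R (0, b) (0, b') (v, 0) (0, w)" for b b' v w
    using J.K2_elem[of b b' v w] by (simp add: hom)
  have pp_mm: "R (0, b) (0, b') (v, 0) (v', 0)" for b b' v v'
    using J.K_K[of b b' v v'] I.K_K'[of v v' b b'] by (simp add: hom)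
  have pp_pp: "R (0, b) (0, b') (0, w) (0, w')" for b b' w w'
    by (simp add: hom zero_prod_def[symmetric])
  have R_split1: "R a b v w" if "R (fst a, 0) b v w" "R (0, snd a) b v w" for a b v w
    using R_add1[OF that] column_split[of a] by simp
  have R_split3: "R a b v w" if "R a b (fst v, 0) w" "R a b (0, snd v) w" for a b v w
    using R_add3[OF that] column_split[of v] by simp
  note R_split2 = R_swap1[OF R_split1[OF R_swap1 R_swap1]]
    and R_split4 = R_swap3[OF R_split3[OF R_swap3 R_swap3]]
  have "R a b v w"
    by (rule R_split1; rule R_split2; rule R_split3; rule R_split4)
      (blast intro: mp_mp mp_mm mp_pp mm_mp mm_mm mm_pp pp_mp pp_mm pp_pp
        R_swap1[OF mp_mp] R_swap1[OF mp_mm] R_swap1[OF mp_pp]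
        R_swap3[OF mp_mp] R_swap3[OF mm_mp] R_swap3[OF pp_mp] R_swap1[OF R_swap3[OF mp_mp]])+
  then show ?thesis unfolding R_def by blast
qed

end

section \<open>The Kantor Lie algebra as a graded Lie algebra\<close>

abbreviation five_sum :: "(int \<Rightarrow> 'a::ab_group_add) \<Rightarrow> 'a" where
  "five_sum c \<equiv> c (-2) + c (-1) + c 0 + c 1 + c 2"

text \<open>Gradings are defined through sums over the support of c. Turning such a sum into a fixed
  five-term expression lets two decompositions be added and compared termwise.\<close>

lemma sum_eq_five_sum:
  fixes c :: "int \<Rightarrow> 'a::ab_group_add"
  assumes "\<And>i. \<bar>i\<bar> > 2 \<Longrightarrow> c i = 0"
  shows "finite {i. c i \<noteq> 0}" "(\<Sum>i | c i \<noteq> 0. c i) = five_sum c"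
proof -
  have sub: "{i. c i \<noteq> 0} \<subseteq> {-2, -1, 0, 1, 2}"
  proof
    fix i assume "i \<in> {i. c i \<noteq> 0}"
    then have "\<bar>i\<bar> \<le> 2" using assms[of i] by (metis mem_Collect_eq not_le)
    then have "i = -2 \<or> i = -1 \<or> i = 0 \<or> i = 1 \<or> i = 2" by arith
    then show "i \<in> {-2, -1, 0, 1, 2}" by auto
  qed
  then show "finite {i. c i \<noteq> 0}" by (rule finite_subset) simp
  have "(\<Sum>i | c i \<noteq> 0. c i) = (\<Sum>i\<in>{-2, -1, 0, 1, 2}. c i)"
    by (rule sum.mono_neutral_left) (use sub in auto)
  then show "(\<Sum>i | c i \<noteq> 0. c i) = five_sum c" by (simp add: add_ac)
qed

lemma five_cases:
  fixes i :: int
  obtains "i = -2" | "i = -1" | "i = 0" | "i = 1" | "i = 2" | "\<bar>i\<bar> > 2"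
proof -
  have "i = -2 \<or> i = -1 \<or> i = 0 \<or> i = 1 \<or> i = 2 \<or> \<bar>i\<bar> > 2" by arith
  then show thesis using that by blast
qed

context kantor_pair_loc
begin

abbreviation (input) col where "col \<equiv> smult_column P"
abbreviation (input) mat where "mat \<equiv> smult_matrix P"

lemma module_col: "module col"
  by unfold_locales (auto simp: smult_column_def sc_simps M.scale_left_distrib Q.scale_left_distrib)

lemma module_mat: "module mat"
  by unfold_locales
    (auto simp: smult_matrix_def smult_column_def split_beta fun_eq_iff prod_eq_iff sc_simps
      M.scale_left_distrib Q.scale_left_distrib)

sublocale C: module col by (rule module_col)
sublocale A: module mat by (rule module_mat)

lemma mat_apply: "mat a A v = col a (A v)"
  by (simp add: smult_matrix_def)

lemma cb_zero_op [simp]: "cb 0 y = 0" "cb x 0 = 0"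
  by (simp_all add: fun_eq_iff)

lemma cb_anti_op: "cb x y = - cb y x"
  by (rule ext) (simp add: cb_anti[of x y])

lemma generator_eq_cb:
  "mat2 (D_op tm xm xp) (K_op tm ym zm) (K_op tp yp zp) (- D_op tp xp xm)
     = cb (xm, 0) (0, xp) + cb (ym, 0) (zm, 0) + cb (0, yp) (0, zp)"
  by (rule ext) (auto simp: cb_homogeneous mat2_def D_op_def)

lemma generator0_eq_cb:
  "mat2 (D_op tm xm xp) 0 0 (- D_op tp xp xm) = cb (xm, 0) (0, xp)"
  by (rule ext) (auto simp: cb_homogeneous mat2_def D_op_def)

lemma subspace_S: "A.subspace (kantor_S P)"
  by (simp add: kantor_S_def)

lemma cb_in_S: "cb x y \<in> kantor_S P"
proof -
  obtain xm xp ym yp where [simp]: "x = (xm, xp)" "y = (ym, yp)" by (metis surj_pair)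
  let ?G = "\<lambda>xm xp ym zm yp zp. mat2 (D_op tm xm xp) (K_op tm ym zm) (K_op tp yp zp) (- D_op tp xp xm)"
  \<comment> \<open>The diagonal of \<open>cb x y\<close> contains two D-terms, but a generator
    supplies one. The second comes from another generator whose K-entries are zero.\<close>
  have "cb x y = ?G xm yp xm ym xp yp - ?G ym xp 0 0 0 0"
    unfolding generator_eq_cb
    by (rule ext) (simp add: cb_eq prod_eq_iff tm_simps tp_simps algebra_simps)
  moreover have "?G a b c d e f \<in> kantor_S P" for a b c d e f
    unfolding kantor_S_def by (rule A.span_base) blast
  ultimately show ?thesis using A.subspace_diff[OF subspace_S] by simp
qed

text \<open>This exhibits S(P) as the inner derivations of the Lie triple system, so inductions over
  S(P) have a single generator case.\<close>

lemma kantor_S_eq_span: "kantor_S P = A.span {cb x y | x y. True}"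
proof (rule subset_antisym)
  show "kantor_S P \<subseteq> A.span {cb x y | x y. True}"
    unfolding kantor_S_def generator_eq_cb
    by (rule A.span_minimal, clarify, intro A.span_add A.span_base; blast)
  show "A.span {cb x y | x y. True} \<subseteq> kantor_S P"
    by (rule A.span_minimal) (use cb_in_S in \<open>auto simp: kantor_S_def\<close>)
qed

lemma kantor_S0_eq_span: "kantor_S0 P = A.span {cb (x, 0) (0, y) | x y. True}"
  by (simp add: kantor_S0_def generator0_eq_cb)

lemma kantor_S_induct [consumes 1, case_names cb zero add scale]:
  assumes "A \<in> kantor_S P" "\<And>x y. Q (cb x y)" "Q 0" "\<And>A B. Q A \<Longrightarrow> Q B \<Longrightarrow> Q (A + B)"
    "\<And>a A. Q A \<Longrightarrow> Q (mat a A)"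
  shows "Q A"
proof -
  have "A.subspace {A. Q A}" using assms by (auto simp: A.subspace_def)
  then show ?thesis
    using A.span_induct[of A "{cb x y | x y. True}" Q] assms by (auto simp: kantor_S_eq_span)
qed

lemma S_add: "A \<in> kantor_S P \<Longrightarrow> A (x + y) = A x + A y"
  by (induct rule: kantor_S_induct)
    (auto simp: cb_add mat_apply C.scale_right_distrib plus_fun_def add_ac)

lemma S_zero: "A \<in> kantor_S P \<Longrightarrow> A 0 = 0"
  using S_add[of A 0 0] by simp

lemma S_minus: "A \<in> kantor_S P \<Longrightarrow> A (- x) = - A x"
  using S_add[of A x "- x"] S_zero[of A] by (simp add: eq_neg_iff_add_eq_0 add.commute)

lemma S_diff: "A \<in> kantor_S P \<Longrightarrow> A (x - y) = A x - A y"
  using S_add[of A x "- y"] S_minus[of A y] by simp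

lemma S_scale: "A \<in> kantor_S P \<Longrightarrow> A (col a x) = col a (A x)"
  by (induct rule: kantor_S_induct)
    (auto simp: cb_scale mat_apply C.scale_right_distrib plus_fun_def mult.commute)

lemma S_cb_derivation:
  "A \<in> kantor_S P \<Longrightarrow> A (cb v w c) - cb v w (A c) = cb (A v) w c + cb v (A w) c"
proof (induct rule: kantor_S_induct)
  case (cb x y)
  show ?case by (rule cb_derivation)
next
  case (add A B)
  from arg_cong2[OF add, of "(+)"] show ?case
    by (simp add: plus_fun_def cb_add algebra_simps)
next
  case (scale a A)
  from arg_cong[OF scale, of "col a"] show ?case
    by (simp add: mat_apply cb_scale C.scale_right_distrib C.scale_right_diff_distrib)
qed simp

text \<open>Each A in S(P) is a derivation of \<open>cb\<close>. This one formula gives closure of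
  S(P) under commutators and the mixed terms of the Jacobi identity.\<close>

lemma S_cb_commutator:
  assumes "A \<in> kantor_S P"
  shows "(A \<circ> cb v w) - (cb v w \<circ> A) = cb (A v) w + cb v (A w)"
  by (rule ext) (use S_cb_derivation[OF assms] in simp)

lemma S_commutator:
  assumes A: "A \<in> kantor_S P" and B: "B \<in> kantor_S P"
  shows "(A \<circ> B) - (B \<circ> A) \<in> kantor_S P"
  using B
proof (induct rule: kantor_S_induct)
  case (cb x y)
  show ?case unfolding S_cb_commutator[OF A] by (intro A.subspace_add subspace_S cb_in_S)
next
  case zero
  have "(A \<circ> 0) - (0 \<circ> A) = 0" using S_zero[OF A] by (simp add: fun_eq_iff)
  then show ?case using A.subspace_0[OF subspace_S] by (simp only:)
next
  case (add B B')
  have "(A \<circ> (B + B')) - ((B + B') \<circ> A) = ((A \<circ> B) - (B \<circ> A)) + ((A \<circ> B') - (B' \<circ> A))"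
    by (simp add: fun_eq_iff S_add[OF A] algebra_simps)
  then show ?case using A.subspace_add[OF subspace_S add(1,2)] by (simp only:)
next
  case (scale a B)
  have "(A \<circ> mat a B) - (mat a B \<circ> A) = mat a ((A \<circ> B) - (B \<circ> A))"
    by (simp add: fun_eq_iff mat_apply S_scale[OF A] C.scale_right_diff_distrib)
  then show ?case using A.subspace_scale[OF subspace_S scale(1)] by (simp only:)
qed

text \<open>Columns of degree \<open>k\<close>, and maps that raise the degree by \<open>i\<close>: this describes all pieces of
  the standard grading uniformly.\<close>

definition column_grade :: "int \<Rightarrow> ('m \<times> 'p) set" where
  "column_grade k = {h. (k \<noteq> -1 \<longrightarrow> fst h = 0) \<and> (k \<noteq> 1 \<longrightarrow> snd h = 0)}"

lemma column_grade_eqs: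
  "column_grade (-1) = UNIV \<times> {0}" "column_grade 1 = {0} \<times> UNIV"
  "k \<noteq> -1 \<Longrightarrow> k \<noteq> 1 \<Longrightarrow> column_grade k = {0}"
  by (auto simp: column_grade_def prod_eq_iff)

definition shifts :: "int \<Rightarrow> ('m \<times> 'p \<Rightarrow> 'm \<times> 'p) \<Rightarrow> bool" where
  "shifts i A \<longleftrightarrow> (\<forall>k. \<forall>h\<in>column_grade k. A h \<in> column_grade (k + i))"

lemma subspace_column_grade: "C.subspace (column_grade k)"
  by (auto simp: C.subspace_def column_grade_def smult_column_def split_beta)

lemma shifts_cb: "h \<in> column_grade i \<Longrightarrow> h' \<in> column_grade j \<Longrightarrow> shifts (i + j) (cb h h')"
  by (auto simp: shifts_def column_grade_def cb_eq tm_simps tp_simps)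

text \<open>Columns of degree other than -1 and 1 are zero, so only the two halves of the column
  space have to be tested.\<close>

lemma S_shifts_iff:
  assumes "A \<in> kantor_S P"
  shows "shifts i A \<longleftrightarrow> (\<forall>u. A (u, 0) \<in> column_grade (i - 1)) \<and> (\<forall>v. A (0, v) \<in> column_grade (i + 1))"
proof (intro iffI conjI allI)
  assume *: "(\<forall>u. A (u, 0) \<in> column_grade (i - 1)) \<and> (\<forall>v. A (0, v) \<in> column_grade (i + 1))"
  show "shifts i A"
    unfolding shifts_def
  proof (intro allI ballI)
    fix k h assume h: "h \<in> column_grade k"
    consider "k = -1" | "k = 1" | "h = 0"
      using h by (auto simp: column_grade_def prod_eq_iff)
    then show "A h \<in> column_grade (k + i)"
    proof cases
      case 1
      with h have "h = (fst h, 0)" by (simp add: column_grade_def prod_eq_iff)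
      with * 1 show ?thesis by (metis add.commute uminus_add_conv_diff)
    next
      case 2
      with h have "h = (0, snd h)" by (simp add: column_grade_def prod_eq_iff)
      with * 2 show ?thesis by (metis add.commute)
    next
      case 3
      then show ?thesis using S_zero[OF assms] by (simp add: column_grade_def)
    qed
  qed
next
  fix u assume "shifts i A"
  moreover have "(u, 0) \<in> column_grade (-1)" by (simp add: column_grade_def)
  ultimately show "A (u, 0) \<in> column_grade (i - 1)" by (fastforce simp: shifts_def)
next
  fix v assume "shifts i A"
  moreover have "(0, v) \<in> column_grade 1" by (simp add: column_grade_def)
  ultimately show "A (0, v) \<in> column_grade (i + 1)" by (fastforce simp: shifts_def add.commute)
qed

lemma S_apply_split: "A \<in> kantor_S P \<Longrightarrow> A (u, v) = A (u, 0) + A (0, v)"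
  using S_add[of A "(u, 0)" "(0, v)"] unfolding add_Pair add.right_neutral add.left_neutral .

lemma S_eq_zero:
  assumes "A \<in> kantor_S P" "\<And>u. A (u, 0) = 0" "\<And>v. A (0, v) = 0"
  shows "A = 0"
proof
  fix x
  show "A x = 0 x" using S_apply_split[OF assms(1), of "fst x" "snd x"]
    unfolding assms(2,3) by simp
qed

lemma S_eq_mat2:
  assumes "A \<in> kantor_S P"
  shows "A = mat2 (\<lambda>u. fst (A (u, 0))) (\<lambda>v. fst (A (0, v))) (\<lambda>u. snd (A (u, 0))) (\<lambda>v. snd (A (0, v)))"
proof
  fix x
  show "A x = mat2 (\<lambda>u. fst (A (u, 0))) (\<lambda>v. fst (A (0, v))) (\<lambda>u. snd (A (u, 0))) (\<lambda>v. snd (A (0, v))) x"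
    using S_apply_split[OF assms, of "fst x" "snd x"] by (simp add: mat2_def prod_eq_iff split_beta)
qed

lemma subspace_shifts: "A.subspace {A \<in> kantor_S P. shifts i A}"
  using subspace_S subspace_column_grade
  by (auto simp: A.subspace_def C.subspace_def shifts_def mat_apply)

lemma S_decompose:
  assumes "A \<in> kantor_S P"
  obtains B C D where "B \<in> kantor_S P" "shifts (-2) B" "C \<in> kantor_S0 P" "D \<in> kantor_S P" "shifts 2 D"
    "A = B + C + D"
proof -
  have "\<exists>B C D. B \<in> kantor_S P \<and> shifts (-2) B \<and> C \<in> kantor_S0 P \<and> D \<in> kantor_S P \<and> shifts 2 D \<and> A = B + C + D"
    using assms
  proof (induct rule: kantor_S_induct)
    case (cb x y)
    let ?B = "cb (fst x, 0) (fst y, 0)" and ?D = "cb (0, snd x) (0, snd y)"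
      and ?C = "cb (fst x, 0) (0, snd y) - cb (fst y, 0) (0, snd x)"
    have "cb x y = ?B + ?C + ?D"
      by (rule ext) (simp add: cb_homogeneous, simp add: cb_eq K_op_def)
    moreover have "?C \<in> kantor_S0 P"
      unfolding kantor_S0_eq_span by (intro A.span_diff A.span_base) auto
    moreover have "shifts (-2) ?B" "shifts 2 ?D"
      using shifts_cb[of "(fst x, 0)" "-1" "(fst y, 0)" "-1"] shifts_cb[of "(0, snd x)" 1 "(0, snd y)" 1]
      by (simp_all add: column_grade_def)
    ultimately show ?case using cb_in_S by blast
  next
    case zero
    have "shifts i 0" for i by (simp add: shifts_def column_grade_def)
    moreover have "(0::'m \<times> 'p \<Rightarrow> 'm \<times> 'p) = 0 + 0 + 0" by simp
    moreover have "0 \<in> kantor_S0 P" unfolding kantor_S0_eq_span by (rule A.span_zero)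
    ultimately show ?case using A.subspace_0[OF subspace_S] by blast
  next
    case (add A A')
    then obtain B C D B' C' D' where
      "B \<in> kantor_S P" "shifts (-2) B" "C \<in> kantor_S0 P" "D \<in> kantor_S P" "shifts 2 D" "A = B + C + D"
      "B' \<in> kantor_S P" "shifts (-2) B'" "C' \<in> kantor_S0 P" "D' \<in> kantor_S P" "shifts 2 D'" "A' = B' + C' + D'"
      by blast
    moreover from this have "B + B' \<in> {A \<in> kantor_S P. shifts (-2) A}" "D + D' \<in> {A \<in> kantor_S P. shifts 2 A}"
      by (auto intro!: A.subspace_add[OF subspace_shifts, simplified])
    moreover have "C + C' \<in> kantor_S0 P"
      using calculation by (simp only: kantor_S0_eq_span A.span_add)
    moreover have "A + A' = (B + B') + (C + C') + (D + D')"
      unfolding calculation(6,12) by (simp only: add_ac)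
    ultimately show ?case by blast
  next
    case (scale a A)
    then obtain B C D where
      "B \<in> kantor_S P" "shifts (-2) B" "C \<in> kantor_S0 P" "D \<in> kantor_S P" "shifts 2 D" "A = B + C + D"
      by blast
    moreover from this have "mat a B \<in> {A \<in> kantor_S P. shifts (-2) A}" "mat a D \<in> {A \<in> kantor_S P. shifts 2 A}"
      by (auto intro!: A.subspace_scale[OF subspace_shifts, simplified])
    moreover have "mat a C \<in> kantor_S0 P"
      using calculation by (simp only: kantor_S0_eq_span A.span_scale)
    moreover have "mat a A = mat a B + mat a C + mat a D"
      unfolding calculation(6) by (simp only: A.scale_right_distrib)
    ultimately show ?case by blast
  qed
  then show thesis using that by blast
qed

lemma S0_subset: "kantor_S0 P \<subseteq> {A \<in> kantor_S P. shifts 0 A}"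
  unfolding kantor_S0_eq_span
proof (rule A.span_minimal[OF _ subspace_shifts])
  show "{cb (x, 0) (0, y) |x y. True} \<subseteq> {A \<in> kantor_S P. shifts 0 A}"
    using shifts_cb[of "(_, 0)" "-1" "(0, _)" 1] cb_in_S by (auto simp: column_grade_def)
qed

text \<open>Applied to a column of degree -1, the three summands land in degrees -3, -1, 1; applied
  to one of degree 1, in -1, 1, 3. Degrees -3 and 3 are zero and the others are different entries,
  so nothing can cancel.\<close>

lemma shifts_independent:
  assumes "B \<in> kantor_S P" "shifts (-2) B" "C \<in> kantor_S P" "shifts 0 C" "D \<in> kantor_S P" "shifts 2 D"
    and "B + C + D = 0"
  shows "B = 0" "C = 0" "D = 0"
proof -
  have *: "B h + C h + D h = 0" for h using fun_cong[OF assms(7), of h] by simp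
  have h: "(u, 0) \<in> column_grade (-1)" "(0, v) \<in> column_grade 1" for u v
    by (simp_all add: column_grade_def)
  note sh = assms(2,4,6)[unfolded S_shifts_iff[OF assms(1)] S_shifts_iff[OF assms(3)] S_shifts_iff[OF assms(5)]]
  have "B (u, 0) = 0" "C (u, 0) = 0" "D (u, 0) = 0" for u
    using sh *[of "(u, 0)"] by (auto simp: column_grade_def prod_eq_iff)
  moreover have "B (0, v) = 0" "C (0, v) = 0" "D (0, v) = 0" for v
    using sh *[of "(0, v)"] by (auto simp: column_grade_def prod_eq_iff)
  ultimately show "B = 0" "C = 0" "D = 0"
    using assms(1,3,5) by (blast intro: S_eq_zero)+
qed

text \<open>The degree 0 part is defined as a span, the degree -2 and 2 parts by matrix shape.
  Decomposing a degree 0 element and comparing by independence shows that the span too is cut out by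
  shape.\<close>

lemma S0_eq: "kantor_S0 P = {A \<in> kantor_S P. shifts 0 A}"
proof (rule subset_antisym[OF S0_subset], rule subsetI)
  fix A assume A: "A \<in> {A \<in> kantor_S P. shifts 0 A}"
  then obtain B C D where d: "B \<in> kantor_S P" "shifts (-2) B" "C \<in> kantor_S0 P" "D \<in> kantor_S P" "shifts 2 D"
    "A = B + C + D" using S_decompose by blast
  have "C - A \<in> {A \<in> kantor_S P. shifts 0 A}"
    using A.subspace_diff[OF subspace_shifts, of C 0 A] A d(3) S0_subset by auto
  then have "C - A = 0"
    using shifts_independent(2)[of B "C - A" D] d by auto
  then show "A \<in> kantor_S0 P" using d(3) by simp
qed

lemma upper_iff: "A \<in> kantor_S P \<Longrightarrow> (\<exists>B. A = mat2 0 B 0 0) \<longleftrightarrow> shifts (-2) A"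
proof
  assume A: "A \<in> kantor_S P" and "shifts (-2) A"
  then have "A = mat2 0 (\<lambda>v. fst (A (0, v))) 0 0"
    by - (rule trans[OF S_eq_mat2[OF A]],
      auto simp: S_shifts_iff[OF A] mat2_def fun_eq_iff column_grade_def)
  then show "\<exists>B. A = mat2 0 B 0 0" by blast
qed (auto simp: S_shifts_iff mat2_def column_grade_def zero_prod_def dest: S_zero)

lemma lower_iff: "A \<in> kantor_S P \<Longrightarrow> (\<exists>B. A = mat2 0 0 B 0) \<longleftrightarrow> shifts 2 A"
proof
  assume A: "A \<in> kantor_S P" and "shifts 2 A"
  then have "A = mat2 0 0 (\<lambda>u. snd (A (u, 0))) 0"
    by - (rule trans[OF S_eq_mat2[OF A]],
      auto simp: S_shifts_iff[OF A] mat2_def fun_eq_iff column_grade_def)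
  then show "\<exists>B. A = mat2 0 0 B 0" by blast
qed (auto simp: S_shifts_iff mat2_def column_grade_def zero_prod_def dest: S_zero)

lemma shifts_trivial:
  assumes A: "A \<in> kantor_S P" "shifts i A" and i: "i \<notin> {-2, 0, 2}"
  shows "A = 0"
proof -
  have "A (u, 0) = 0" "A (0, v) = 0" for u v
    using A i by (auto simp: S_shifts_iff[OF A(1)] column_grade_def prod_eq_iff)
  then show ?thesis by (rule S_eq_zero[OF A(1)])
qed

lemma kantor_grade: "grade (kantor_lie P) i = {(A, h). A \<in> kantor_S P \<and> shifts i A \<and> h \<in> column_grade i}"
proof -
  have 0: "0 \<in> kantor_S P" "shifts i 0" "0 \<in> column_grade i" for i
    using A.subspace_0[OF subspace_S] by (simp_all add: column_grade_def shifts_def)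
  show ?thesis
  proof (cases "i \<in> {-2, 0, 2}")
    case True
    then show ?thesis
      by (auto simp: kantor_lie_def upper_iff lower_iff S0_eq column_grade_def prod_eq_iff
          intro: upper_iff[THEN iffD1] lower_iff[THEN iffD1])
  next
    case False
    then have "{(A, h). A \<in> kantor_S P \<and> shifts i A \<and> h \<in> column_grade i} = {0} \<times> column_grade i"
      using shifts_trivial[of _ i] 0 by auto
    moreover have "grade (kantor_lie P) i = {0} \<times> column_grade i"
      using False by (simp add: kantor_lie_def column_grade_eqs zero_prod_def)
    ultimately show ?thesis by simp
  qed
qed

lemma kantor_simps:
  "carrier (kantor_lie P) = kantor_S P \<times> UNIV"
  "smult (kantor_lie P) a (A, v) = (mat a A, col a v)"
  "bracket (kantor_lie P) (A, v) (B, w) = ((A \<circ> B) - (B \<circ> A) + cb v w, A w - B v)"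
  by (simp_all add: kantor_lie_def)

lemma module_kantor: "module (smult (kantor_lie P))"
  by unfold_locales
    (auto simp: kantor_simps A.scale_right_distrib A.scale_left_distrib smult_column_def sc_simps
      M.scale_left_distrib Q.scale_left_distrib)

sublocale L: module "smult (kantor_lie P)" by (rule module_kantor)

text \<open>The column component of the Jacobi identity reduces to \<open>cb_jacobi\<close>, since
  the terms with two matrices cancel. The matrix component is the Jacobi identity for commutators
  together with three instances of \<open>S_cb_derivation\<close>.\<close>

lemma lie_kantor: "lie_algebra (kantor_lie P)"
proof -
  let ?L = "kantor_lie P"
  have sub: "L.subspace (carrier ?L)"
    using subspace_S by (auto simp: L.subspace_def A.subspace_def kantor_simps zero_prod_def)
  have closed: "bracket ?L x y \<in> carrier ?L" if "x \<in> carrier ?L" "y \<in> carrier ?L" for x y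
    using that
    by (cases x; cases y) (simp add: kantor_simps A.subspace_add[OF subspace_S] S_commutator cb_in_S)
  have alt: "bracket ?L x x = 0" if "x \<in> carrier ?L" for x
    by (cases x) (simp add: kantor_simps zero_prod_def)
  have anti: "bracket ?L x y = - bracket ?L y x" for x y
  proof -
    obtain A u B v where "x = (A, u)" "y = (B, v)" by (metis surj_pair)
    then show ?thesis using cb_anti_op[of u v] by (simp add: kantor_simps)
  qed
  have add: "bracket ?L x (y + z) = bracket ?L x y + bracket ?L x z" if "x \<in> carrier ?L" for x y z
  proof -
    obtain A u where x: "x = (A, u)" by (cases x)
    then have A: "A \<in> kantor_S P" using that by (simp add: kantor_simps)
    obtain B v C w where yz: "y = (B, v)" "z = (C, w)" by (metis surj_pair)
    have "(A \<circ> (B + C)) - ((B + C) \<circ> A) + cb u (v + w)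
        = ((A \<circ> B) - (B \<circ> A) + cb u v) + ((A \<circ> C) - (C \<circ> A) + cb u w)"
      by (rule ext) (simp add: cb_add S_add[OF A] S_zero[OF A])
    then show ?thesis by (simp add: x yz kantor_simps S_add[OF A] S_zero[OF A])
  qed
  have scale: "bracket ?L x (smult ?L a y) = smult ?L a (bracket ?L x y)" if "x \<in> carrier ?L" for x y a
  proof -
    obtain A u where x: "x = (A, u)" by (cases x)
    then have A: "A \<in> kantor_S P" using that by (simp add: kantor_simps)
    obtain B v where y: "y = (B, v)" by (metis surj_pair)
    have "(A \<circ> mat a B) - (mat a B \<circ> A) + cb u (col a v) = mat a ((A \<circ> B) - (B \<circ> A) + cb u v)"
      by (rule ext) (simp add: cb_scale mat_apply S_scale[OF A] C.scale_right_distrib C.scale_right_diff_distrib)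
    then show ?thesis by (simp add: x y kantor_simps mat_apply S_scale[OF A] C.scale_right_diff_distrib)
  qed
  have lin: "linear_between (smult ?L) (carrier ?L) (smult ?L) (carrier ?L) (bracket ?L x)"
    if "x \<in> carrier ?L" for x
    using closed[OF that] add[OF that] scale[OF that] by (auto simp: linear_between_def)
  have lin': "linear_between (smult ?L) (carrier ?L) (smult ?L) (carrier ?L) (\<lambda>y. bracket ?L y x)"
    if "x \<in> carrier ?L" for x
  proof -
    have "linear_between (smult ?L) (carrier ?L) (smult ?L) (carrier ?L) (\<lambda>y. - bracket ?L x y)"
      unfolding linear_between_def
      by (intro conjI ballI allI funcsetI) (simp_all add: closed L.subspace_neg[OF sub] add scale that)
    then show ?thesis using anti[of _ x] by simp
  qed
  have jac: "bracket ?L x (bracket ?L y z) + bracket ?L y (bracket ?L z x) + bracket ?L z (bracket ?L x y) = 0"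
    if xyz: "x \<in> carrier ?L" "y \<in> carrier ?L" "z \<in> carrier ?L" for x y z
  proof -
    obtain A u B v C w where [simp]: "x = (A, u)" "y = (B, v)" "z = (C, w)" by (metis surj_pair)
    from xyz have S: "A \<in> kantor_S P" "B \<in> kantor_S P" "C \<in> kantor_S P" by (simp_all add: kantor_simps)
    note ops = S_add[OF S(1)] S_add[OF S(2)] S_add[OF S(3)] S_diff[OF S(1)] S_diff[OF S(2)] S_diff[OF S(3)]
    have "A (B w - C v) - ((B \<circ> C) - (C \<circ> B) + cb v w) u
        + (B (C u - A w) - ((C \<circ> A) - (A \<circ> C) + cb w u) v)
        + (C (A v - B u) - ((A \<circ> B) - (B \<circ> A) + cb u v) w) = 0"
      using cb_jacobi[of u v w] by (simp add: ops algebra_simps S_zero S)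
    moreover have "((A \<circ> ((B \<circ> C) - (C \<circ> B) + cb v w)) - (((B \<circ> C) - (C \<circ> B) + cb v w) \<circ> A) + cb u (B w - C v)) c
        + ((B \<circ> ((C \<circ> A) - (A \<circ> C) + cb w u)) - (((C \<circ> A) - (A \<circ> C) + cb w u) \<circ> B) + cb v (C u - A w)) c
        + ((C \<circ> ((A \<circ> B) - (B \<circ> A) + cb u v)) - (((A \<circ> B) - (B \<circ> A) + cb u v) \<circ> C) + cb w (A v - B u)) c = 0" for c
      using arg_cong2[OF arg_cong2[OF S_cb_derivation[OF S(1), of v w c] S_cb_derivation[OF S(2), of w u c], of "(+)"]
          S_cb_derivation[OF S(3), of u v c], of "(+)"]
        cb_anti[of "B w" u c] cb_anti[of "C u" v c] cb_anti[of "A v" w c]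
      by (simp add: ops cb_diff algebra_simps S_zero S)
    ultimately show ?thesis by (simp add: kantor_simps fun_eq_iff zero_prod_def del: split_paired_All)
  qed
  show ?thesis unfolding lie_algebra_def using module_kantor sub lin lin' alt jac by blast
qed

end

text \<open>Subtracting two decompositions of x turns uniqueness into independence of the pieces,
  which is easier to check for matrices.\<close>

lemma unique_decomposition:
  fixes G :: "int \<Rightarrow> 'a::ab_group_add set"
  assumes diff: "\<And>i x y. x \<in> G i \<Longrightarrow> y \<in> G i \<Longrightarrow> x - y \<in> G i"
    and zero: "\<And>i. \<bar>i\<bar> > 2 \<Longrightarrow> G i = {0}"
    and ex: "\<exists>c. (\<forall>i. c i \<in> G i) \<and> x = five_sum c"
    and indep: "\<And>c i. (\<forall>i. c i \<in> G i) \<Longrightarrow> five_sum c = 0 \<Longrightarrow> c i = 0"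
  shows "\<exists>!c. (\<forall>i. c i \<in> G i) \<and> finite {i. c i \<noteq> 0} \<and> x = (\<Sum>i | c i \<noteq> 0. c i)"
proof -
  have eq: "finite {i. c i \<noteq> 0} \<and> (\<Sum>i | c i \<noteq> 0. c i) = five_sum c" if "\<forall>i. c i \<in> G i" for c
  proof -
    have "c i = 0" if "\<bar>i\<bar> > 2" for i using \<open>\<forall>i. c i \<in> G i\<close> zero[OF that] by auto
    then show ?thesis using sum_eq_five_sum[of c] by simp
  qed
  obtain c where c: "\<forall>i. c i \<in> G i" "x = five_sum c" using ex by blast
  show ?thesis
  proof (rule ex1I[of _ c])
    fix d assume d: "(\<forall>i. d i \<in> G i) \<and> finite {i. d i \<noteq> 0} \<and> x = (\<Sum>i | d i \<noteq> 0. d i)"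
    then have "five_sum d = five_sum c" using c(2) eq[of d] by simp
    moreover have "five_sum (\<lambda>i. d i - c i) = five_sum d - five_sum c" by (simp only: add_diff_add)
    ultimately have "five_sum (\<lambda>i. d i - c i) = 0" by simp
    then have "d i - c i = 0" for i using indep[of "\<lambda>i. d i - c i"] diff d c(1) by blast
    then show "d = c" by (simp add: fun_eq_iff)
  qed (use c eq in auto)
qed

section \<open>5-graded Lie algebras and enveloping algebras\<close>

locale five_graded =
  fixes L :: "('k::comm_ring_1, 'l::ab_group_add) graded_lie"
  assumes five_graded: "five_graded_lie_algebra L"
begin

abbreviation V where "V \<equiv> carrier L"
abbreviation br where "br \<equiv> bracket L"
abbreviation G where "G \<equiv> grade L"
abbreviation sc where "sc \<equiv> smult L"

lemma graded: "graded_lie_algebra L" and lie: "lie_algebra L"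
  using five_graded by (auto simp: five_graded_lie_algebra_def graded_lie_algebra_def)

sublocale N: module sc using lie by (simp add: lie_algebra_def)

lemma subspace_V: "N.subspace V" using lie by (simp add: lie_algebra_def)
lemma subspace_G: "N.subspace (G i)" using graded by (simp add: graded_lie_algebra_def)
lemma G_subset: "x \<in> G i \<Longrightarrow> x \<in> V" using graded by (auto simp: graded_lie_algebra_def)

lemmas V_closed [simp, intro] = N.subspace_0[OF subspace_V] N.subspace_add[OF subspace_V]
  N.subspace_diff[OF subspace_V] N.subspace_neg[OF subspace_V] N.subspace_scale[OF subspace_V]
lemmas G_closed [simp, intro] = N.subspace_0[OF subspace_G] N.subspace_add[OF subspace_G]
  N.subspace_diff[OF subspace_G] N.subspace_neg[OF subspace_G] N.subspace_scale[OF subspace_G]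

lemma br_closed [simp, intro]: "x \<in> V \<Longrightarrow> y \<in> V \<Longrightarrow> br x y \<in> V"
  using lie by (auto simp: lie_algebra_def linear_between_def)

lemma br_add: "x \<in> V \<Longrightarrow> y \<in> V \<Longrightarrow> z \<in> V \<Longrightarrow> br x (y + z) = br x y + br x z"
    "x \<in> V \<Longrightarrow> y \<in> V \<Longrightarrow> z \<in> V \<Longrightarrow> br (x + y) z = br x z + br y z"
  and br_scale: "x \<in> V \<Longrightarrow> y \<in> V \<Longrightarrow> br x (sc a y) = sc a (br x y)"
    "x \<in> V \<Longrightarrow> y \<in> V \<Longrightarrow> br (sc a x) y = sc a (br x y)"
  and br_same: "x \<in> V \<Longrightarrow> br x x = 0"
  and br_cyclic: "x \<in> V \<Longrightarrow> y \<in> V \<Longrightarrow> z \<in> V \<Longrightarrow> br x (br y z) + br y (br z x) + br z (br x y) = 0"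
  using lie by (simp_all add: lie_algebra_def linear_between_def)

lemma br_zero [simp]: "x \<in> V \<Longrightarrow> br x 0 = 0" "x \<in> V \<Longrightarrow> br 0 x = 0"
  using br_scale(1)[of x 0 0] br_scale(2)[of 0 x 0] by auto

lemma br_minus: "x \<in> V \<Longrightarrow> y \<in> V \<Longrightarrow> br x (- y) = - br x y" "x \<in> V \<Longrightarrow> y \<in> V \<Longrightarrow> br (- x) y = - br x y"
  using br_add(1)[of x y "- y"] br_add(2)[of x "- x" y] by (simp_all add: eq_neg_iff_add_eq_0 add.commute)

lemma br_diff: "x \<in> V \<Longrightarrow> y \<in> V \<Longrightarrow> z \<in> V \<Longrightarrow> br x (y - z) = br x y - br x z"
    "x \<in> V \<Longrightarrow> y \<in> V \<Longrightarrow> z \<in> V \<Longrightarrow> br (x - y) z = br x z - br y z"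
  using br_add(1)[of x y "- z"] br_add(2)[of x "- y" z] by (simp_all add: br_minus)

lemma br_anti:
  assumes "x \<in> V" "y \<in> V"
  shows "br x y = - br y x"
  using br_same[OF V_closed(2)[OF assms]] br_same[OF assms(1)] br_same[OF assms(2)] assms
  by (simp add: br_add eq_neg_iff_add_eq_0 add.commute)

lemma br_jacobi:
  assumes "x \<in> V" "y \<in> V" "z \<in> V"
  shows "br (br x y) z = br x (br y z) - br y (br x z)"
  using br_cyclic[OF assms] br_anti[OF assms(3) br_closed[OF assms(1,2)]] br_anti[OF assms(3,1)] assms
  by (simp add: br_minus algebra_simps)

lemma G_zero: "\<bar>i\<bar> > 2 \<Longrightarrow> x \<in> G i \<Longrightarrow> x = 0"
  using five_graded by (auto simp: five_graded_lie_algebra_def)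

lemma br_G: "x \<in> G i \<Longrightarrow> y \<in> G j \<Longrightarrow> i + j = k \<Longrightarrow> br x y \<in> G k"
  using graded by (auto simp: graded_lie_algebra_def)

definition component :: "int \<Rightarrow> 'l \<Rightarrow> 'l" where
  "component i x = (THE c. (\<forall>i. c i \<in> G i) \<and> finite {i. c i \<noteq> 0} \<and> x = (\<Sum>i | c i \<noteq> 0. c i)) i"

abbreviation p where "p \<equiv> component"

lemma G_sum: "\<forall>i. c i \<in> G i \<Longrightarrow> finite {i. c i \<noteq> 0} \<and> (\<Sum>i | c i \<noteq> 0. c i) = five_sum c"
  by (intro conjI sum_eq_five_sum; blast intro: G_zero)

lemma decomposition: "x \<in> V \<Longrightarrow> \<exists>!c. (\<forall>i. c i \<in> G i) \<and> finite {i. c i \<noteq> 0} \<and> x = (\<Sum>i | c i \<noteq> 0. c i)"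
  using graded by (simp add: graded_lie_algebra_def)

lemma p_in [simp, intro]: "x \<in> V \<Longrightarrow> p i x \<in> G i"
  using theI'[OF decomposition[of x]] by (simp add: component_def)

lemma p_V [simp, intro]: "x \<in> V \<Longrightarrow> p i x \<in> V"
  by (rule G_subset[OF p_in])

lemma p_sum: "x \<in> V \<Longrightarrow> five_sum (\<lambda>i. p i x) = x"
  using theI'[OF decomposition[of x]] G_sum[of "\<lambda>i. p i x"] by (simp add: component_def)

lemma p_unique:
  assumes c: "\<forall>i. c i \<in> G i" and x: "x = five_sum c"
  shows "p i x = c i"
proof -
  have "x \<in> V" unfolding x using c G_subset by blast
  from the1_equality[OF decomposition[OF this], of c] show ?thesis
    using G_sum[OF c] c x by (simp add: component_def)
qed

lemma p_hom: "x \<in> G i \<Longrightarrow> p j x = (if j = i then x else 0)"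
  by (rule p_unique, simp, cases i rule: five_cases) (auto dest: G_zero)

lemma p_add: "x \<in> V \<Longrightarrow> y \<in> V \<Longrightarrow> p i (x + y) = p i x + p i y"
  by (rule p_unique, simp, subst (1 2) p_sum[symmetric]) (simp_all add: add_ac)

lemma p_scale: "x \<in> V \<Longrightarrow> p i (sc a x) = sc a (p i x)"
  by (rule p_unique, simp, subst p_sum[symmetric]) (simp_all add: N.scale_right_distrib)

lemma p_zero [simp]: "p i 0 = 0"
  using p_hom[of 0 i i] by simp

lemma p_minus: "x \<in> V \<Longrightarrow> p i (- x) = - p i x"
  using p_add[of x "- x" i] by (simp add: eq_neg_iff_add_eq_0 add.commute)

lemma p_outside [simp]: "x \<in> V \<Longrightarrow> \<bar>i\<bar> > 2 \<Longrightarrow> p i x = 0"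
  using G_zero[of i "p i x"] by simp

lemma p_eqI: "x \<in> V \<Longrightarrow> y \<in> V \<Longrightarrow> (\<And>i. p i x = p i y) \<Longrightarrow> x = y"
  by (metis p_sum)

lemma p_br_hom:
  assumes y: "y \<in> G k" and x: "x \<in> V"
  shows "p i (br y x) = br y (p (i - k) x)"
proof (rule p_unique)
  show "\<forall>i. br y (p (i - k) x) \<in> G i" by (intro allI br_G[OF y p_in[OF x]]) simp
  \<comment> \<open>Passing from the index j to i = j + k moves the five-term window. The terms that
    leave it are killed by \<open>out\<close>, those that enter it by
    \<open>p_outside\<close>.\<close>
  have out: "br y (p j x) = 0" if "\<bar>k + j\<bar> > 2" for j
    using G_zero[OF that br_G[OF y p_in[OF x] refl]] .
  have "br y x = five_sum (\<lambda>j. br y (p j x))"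
    using G_subset[OF y] x by (subst p_sum[OF x, symmetric]) (simp only: br_add p_V V_closed)
  also have "\<dots> = five_sum (\<lambda>i. br y (p (i - k) x))"
  proof (cases k rule: five_cases)
    case 6
    with y have "y = 0" by (blast dest: G_zero)
    then show ?thesis using x by simp
  qed (use x G_subset[OF y] out in \<open>simp_all\<close>)
  finally show "br y x = five_sum (\<lambda>i. br y (p (i - k) x))" .
qed

lemma p_br:
  assumes "y \<in> V" "x \<in> V"
  shows "p i (br y x) = five_sum (\<lambda>k. br (p k y) (p (i - k) x))"
proof -
  have "br y x = five_sum (\<lambda>k. br (p k y) x)"
    using assms by (subst p_sum[OF assms(1), symmetric]) (simp only: br_add p_V V_closed)
  then show ?thesis
    using assms by (simp only: p_add br_closed V_closed p_V p_br_hom[OF p_in])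
qed

section \<open>The Z/2-grading by parity of the degree\<close>

definition even_part :: "'l set" where
  "even_part = {x \<in> V. p (-1) x = 0 \<and> p 1 x = 0}"

definition odd_part :: "'l set" where
  "odd_part = {x \<in> V. p (-2) x = 0 \<and> p 0 x = 0 \<and> p 2 x = 0}"

lemma subspace_even: "N.subspace even_part"
  by (auto simp: N.subspace_def even_part_def p_add p_scale)

lemma subspace_odd: "N.subspace odd_part"
  by (auto simp: N.subspace_def odd_part_def p_add p_scale)

lemma even_V: "x \<in> even_part \<Longrightarrow> x \<in> V" and odd_V: "x \<in> odd_part \<Longrightarrow> x \<in> V"
  by (simp_all add: even_part_def odd_part_def)

lemma even_even: "x \<in> even_part \<Longrightarrow> y \<in> even_part \<Longrightarrow> br x y \<in> even_part"
  and even_odd: "x \<in> even_part \<Longrightarrow> y \<in> odd_part \<Longrightarrow> br x y \<in> odd_part"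
  and odd_odd: "x \<in> odd_part \<Longrightarrow> y \<in> odd_part \<Longrightarrow> br x y \<in> even_part"
  by (simp_all add: even_part_def odd_part_def p_br)

definition even_of :: "'l \<Rightarrow> 'l" where "even_of x = p (-2) x + p 0 x + p 2 x"
definition odd_of :: "'l \<Rightarrow> 'l" where "odd_of x = p (-1) x + p 1 x"

lemma p_p: "x \<in> V \<Longrightarrow> p i (p j x) = (if i = j then p j x else 0)"
  by (rule p_hom) simp

lemma even_of_in: "x \<in> V \<Longrightarrow> even_of x \<in> even_part"
  by (simp add: even_part_def even_of_def p_add p_p)

lemma odd_of_in: "x \<in> V \<Longrightarrow> odd_of x \<in> odd_part"
  by (simp add: odd_part_def odd_of_def p_add p_p)

lemma even_odd_sum: "x \<in> V \<Longrightarrow> even_of x + odd_of x = x"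
  unfolding even_of_def odd_of_def by (subst (6) p_sum[symmetric]) (simp_all add: add_ac)

lemma even_of_even: "x \<in> even_part \<Longrightarrow> even_of x = x" "x \<in> even_part \<Longrightarrow> odd_of x = 0"
  using even_odd_sum[of x] by (auto simp: even_part_def odd_of_def)

lemma odd_of_odd: "x \<in> odd_part \<Longrightarrow> odd_of x = x" "x \<in> odd_part \<Longrightarrow> even_of x = 0"
  using even_odd_sum[of x] by (auto simp: odd_part_def even_of_def)

lemma even_of_linear: "x \<in> V \<Longrightarrow> y \<in> V \<Longrightarrow> even_of (x + y) = even_of x + even_of y"
    "x \<in> V \<Longrightarrow> even_of (sc a x) = sc a (even_of x)"
  and odd_of_linear: "x \<in> V \<Longrightarrow> y \<in> V \<Longrightarrow> odd_of (x + y) = odd_of x + odd_of y"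
    "x \<in> V \<Longrightarrow> odd_of (sc a x) = sc a (odd_of x)"
  by (simp_all add: even_of_def odd_of_def p_add p_scale N.scale_right_distrib add_ac)

lemma G_parity: "x \<in> G i \<Longrightarrow> even i \<Longrightarrow> x \<in> even_part" "x \<in> G i \<Longrightarrow> odd i \<Longrightarrow> x \<in> odd_part"
  using G_subset[of x i] by (auto simp: even_part_def odd_part_def p_hom)

text \<open>The candidate ideals built from T are absorbed for different reasons by even and by odd
  multipliers, and every multiplier is a sum of the two.\<close>

lemma ideal_via_parity:
  assumes I: "N.subspace I" "I \<subseteq> V"
    and "\<And>a x. a \<in> even_part \<Longrightarrow> x \<in> I \<Longrightarrow> br a x \<in> I"
    and "\<And>a x. a \<in> odd_part \<Longrightarrow> x \<in> I \<Longrightarrow> br a x \<in> I"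
  shows "lie_ideal L I"
  unfolding lie_ideal_def
proof (intro conjI ballI I)
  fix x y assume x: "x \<in> V" and y: "y \<in> I"
  have "br x y = br (even_of x) y + br (odd_of x) y"
    using x y I even_of_in[OF x] odd_of_in[OF x] even_odd_sum[OF x] br_add(2)[of "even_of x" "odd_of x" y]
    by (auto simp: even_V odd_V)
  then show "br x y \<in> I"
    using assms(3)[OF even_of_in[OF x] y] assms(4)[OF odd_of_in[OF x] y] N.subspace_add[OF I(1)] by simp
qed

end

lemma (in module) subspace_set_sum:
  assumes "subspace S" "subspace T"
  shows "subspace {x + y | x y. x \<in> S \<and> y \<in> T}"
proof (rule subspaceI)
  show "0 \<in> {x + y | x y. x \<in> S \<and> y \<in> T}"
    using subspace_0[OF assms(1)] subspace_0[OF assms(2)] by force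
next
  fix a b assume "a \<in> {x + y | x y. x \<in> S \<and> y \<in> T}" "b \<in> {x + y | x y. x \<in> S \<and> y \<in> T}"
  then obtain x y x' y' where "a = x + y" "b = x' + y'" "x \<in> S" "x' \<in> S" "y \<in> T" "y' \<in> T" by blast
  then show "a + b \<in> {x + y | x y. x \<in> S \<and> y \<in> T}"
    using subspace_add[OF assms(1)] subspace_add[OF assms(2)]
    by (intro CollectI exI[of _ "x + x'"] exI[of _ "y + y'"]) (simp add: add_ac)
next
  fix c a assume "a \<in> {x + y | x y. x \<in> S \<and> y \<in> T}"
  then show "scale c a \<in> {x + y | x y. x \<in> S \<and> y \<in> T}"
    using subspace_scale[OF assms(1)] subspace_scale[OF assms(2)] scale_right_distrib by blast
qed

section \<open>Enveloping algebras and the action of their even part on columns\<close>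

locale enveloping = five_graded L + kantor_pair_loc P
  for L :: "('k::comm_ring_1, 'l::ab_group_add) graded_lie"
    and P :: "('k, 'm::ab_group_add, 'p::ab_group_add) pair" +
  fixes em :: "'m \<Rightarrow> 'l" and ep :: "'p \<Rightarrow> 'l"
  assumes envelops: "envelops L P em ep"
begin

declare split_paired_All [simp del] split_paired_Ex [simp del]

text \<open>Identifies the column space with T, which is exactly \<open>odd_part\<close>; both signs
  are handled at once from here on.\<close>

definition e :: "'m \<times> 'p \<Rightarrow> 'l" where
  "e v = em (fst v) + ep (snd v)"

lemma em_hom: "module_hom sm sc em" and ep_hom: "module_hom sp sc ep"
  and bij_em: "bij_betw em UNIV (G (-1))" and bij_ep: "bij_betw ep UNIV (G 1)"
  and em_triple: "em (tm x y z) = br (br (em x) (ep y)) (em z)"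
  and ep_triple: "ep (tp x' y' z') = br (br (ep x') (em y')) (ep z')"
  using envelops by (simp_all add: envelops_def)

lemmas em_simps = module_hom.add[OF em_hom] module_hom.scale[OF em_hom] module_hom.diff[OF em_hom]
  module_hom.neg[OF em_hom] module_hom.zero[OF em_hom]
lemmas ep_simps = module_hom.add[OF ep_hom] module_hom.scale[OF ep_hom] module_hom.diff[OF ep_hom]
  module_hom.neg[OF ep_hom] module_hom.zero[OF ep_hom]

lemma em_G [simp, intro]: "em x \<in> G (-1)" and ep_G [simp, intro]: "ep y \<in> G 1"
  using bij_em bij_ep by (auto simp: bij_betw_def)

lemma em_V [simp, intro]: "em x \<in> V" and ep_V [simp, intro]: "ep y \<in> V"
  by (auto intro: G_subset)

lemma em_eq_iff [simp]: "em x = em x' \<longleftrightarrow> x = x'" and ep_eq_iff [simp]: "ep y = ep y' \<longleftrightarrow> y = y'"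
  using bij_em bij_ep by (auto simp: bij_betw_def inj_on_def)

lemma em_eq_0_iff: "em x = 0 \<longleftrightarrow> x = 0" and ep_eq_0_iff: "ep y = 0 \<longleftrightarrow> y = 0"
  using em_eq_iff[of x 0] ep_eq_iff[of y 0] by (auto simp: em_simps ep_simps)

lemma G_m1E: assumes "x \<in> G (-1)" obtains u where "x = em u"
  using assms bij_em by (auto simp: bij_betw_def)

lemma G_1E: assumes "x \<in> G 1" obtains u where "x = ep u"
  using assms bij_ep by (auto simp: bij_betw_def)

lemma p_e: "p i (e v) = (if i = -1 then em (fst v) else if i = 1 then ep (snd v) else 0)"
  by (auto simp: e_def p_add p_hom[OF em_G] p_hom[OF ep_G])

lemma e_V [simp, intro]: "e v \<in> V" by (simp add: e_def)

lemma e_odd [simp, intro]: "e v \<in> odd_part"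
  by (simp add: odd_part_def p_e)

lemma odd_e: assumes "x \<in> odd_part" obtains v where "x = e v"
proof -
  have x: "x \<in> V" using assms by (rule odd_V)
  obtain u v where "p (-1) x = em u" "p 1 x = ep v"
    using G_m1E[OF p_in[OF x]] G_1E[OF p_in[OF x]] by metis
  then have "x = e (u, v)"
    using odd_of_odd(1)[OF assms] by (simp add: e_def odd_of_def)
  then show thesis by (rule that)
qed

lemma e_add: "e (x + y) = e x + e y" and e_scale: "e (col a x) = sc a (e x)"
  and e_diff: "e (x - y) = e x - e y" and e_zero [simp]: "e 0 = 0"
  by (simp_all add: e_def em_simps ep_simps smult_column_def split_beta N.scale_right_distrib)

lemma e_eq_iff [simp]: "e x = e y \<longleftrightarrow> x = y"
proof
  assume "e x = e y"
  then have "p i (e x) = p i (e y)" for i by simp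
  from this[of "-1"] this[of 1] show "x = y" by (simp add: p_e prod_eq_iff)
qed simp

lemma e_eq_0_iff [simp]: "e x = 0 \<longleftrightarrow> x = 0"
  using e_eq_iff[of x 0] by simp

text \<open>The link between L and P: Jacobi rewrites [[x,x'],y] for x, x' of equal sign as a
  difference of two triple products, which is K. Hence double brackets within T do not depend on the
  choice of L.\<close>

lemma e_triple: "br (br (e x) (e y)) (e z) = e (cb x y z)"
proof -
  have K: "br (br (em x) (em x')) (ep y) = em (K_op tm x x' y)"
    "br (br (ep y) (ep y')) (em x) = ep (K_op tp y y' x)" for x x' y y'
    using br_anti[of "em x" "br (em x') (ep y)"] br_anti[of "em x'" "br (em x) (ep y)"]
      br_anti[of "ep y" "br (ep y') (em x)"] br_anti[of "ep y'" "br (ep y) (em x)"]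
    by (simp_all add: br_jacobi[of "em x" "em x'"] br_jacobi[of "ep y" "ep y'"] K_op_def em_simps ep_simps
        em_triple ep_triple)
  have M: "br (br (ep y) (em x)) (em x') = - em (tm x y x')"
    "br (br (em x) (ep y)) (ep y') = - ep (tp y x y')" for x x' y y'
    using br_anti[of "ep y" "em x"] br_anti[of "em x" "ep y"]
    by (simp_all add: br_minus em_triple ep_triple)
  \<comment> \<open>Three factors of equal sign have total degree -3 or 3.\<close>
  have Z: "br (br (em a) (em b)) (em c) = 0" "br (br (ep a') (ep b')) (ep c') = 0" for a b c a' b' c'
    using G_zero[of "-3"] G_zero[of 3] br_G[OF br_G[OF em_G em_G refl] em_G refl, of a b c]
      br_G[OF br_G[OF ep_G ep_G refl] ep_G refl, of a' b' c'] by auto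
  have "br (br (e x) (e y)) (e z) = em (tm (fst x) (snd y) (fst z) - tm (fst y) (snd x) (fst z)
       + K_op tm (fst x) (fst y) (snd z)) + ep (K_op tp (snd x) (snd y) (fst z)
       + (tp (snd x) (fst y) (snd z) - tp (snd y) (fst x) (snd z)))"
    unfolding e_def by (simp add: br_add K M Z em_triple[symmetric] ep_triple[symmetric] em_simps ep_simps)
  then show ?thesis by (simp add: e_def cb_eq K_op_def)
qed

text \<open>For even a, the bracket with T stays in T, the range of \<open>e\<close>, so
  \<open>inv e\<close> is a genuine inverse there (\<open>e_act\<close>).\<close>

definition act :: "'l \<Rightarrow> 'm \<times> 'p \<Rightarrow> 'm \<times> 'p" where
  "act a v = inv e (br a (e v))"

lemma inj_e: "inj e" by (rule injI) simp

lemma inv_e [simp]: "inv e (e v) = v" by (rule inv_f_f[OF inj_e])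

lemma e_act: assumes "a \<in> even_part" shows "br a (e v) = e (act a v)"
proof -
  obtain w where "br a (e v) = e w" using odd_e[OF even_odd[OF assms e_odd]] .
  then show ?thesis by (simp add: act_def)
qed

lemma br_e_even [simp, intro]: "br (e x) (e y) \<in> even_part"
  by (intro odd_odd e_odd)

lemma act_br_e [simp]: "act (br (e x) (e y)) = cb x y"
  by (rule ext) (simp add: act_def e_triple)

lemma br_even_br_e:
  assumes a: "a \<in> even_part"
  shows "br a (br (e x) (e y)) = br (e (act a x)) (e y) + br (e x) (e (act a y))"
  using br_jacobi[of a "e x" "e y"] even_V[OF a] by (simp add: e_act[OF a])

lemma subspace_br_vimage: "a \<in> V \<Longrightarrow> N.subspace S \<Longrightarrow> N.subspace {y \<in> V. br a y \<in> S}"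
  by (auto simp: N.subspace_def br_add br_scale)

lemma span_br_induct:
  assumes "y \<in> N.span B" "B \<subseteq> V" "a \<in> V" "N.subspace S" "\<And>b. b \<in> B \<Longrightarrow> br a b \<in> S"
  shows "br a y \<in> S"
proof -
  have "N.span B \<subseteq> {y \<in> V. br a y \<in> S}"
    using assms by (intro N.span_minimal subspace_br_vimage) auto
  then show ?thesis using assms(1) by blast
qed

end

text \<open>In terms of \<open>act\<close> on the even part: \<open>generated\<close> forces its
  values into S(P), and \<open>faithful\<close> makes it injective.\<close>

locale tight_enveloping = enveloping L P em ep
  for L :: "('k::comm_ring_1, 'l::ab_group_add) graded_lie"
    and P :: "('k, 'm::ab_group_add, 'p::ab_group_add) pair" and em ep +
  assumes generated: "even_part \<subseteq> N.span {br (e x) (e y) | x y. True}"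
    and faithful: "a \<in> even_part \<Longrightarrow> (\<And>v. br a (e v) = 0) \<Longrightarrow> a = 0"

section \<open>Simple envelopes are tight\<close>

context enveloping
begin

lemma nonzero_column:
  assumes "nonzero_pair P"
  obtains v :: "'m \<times> 'p" where "v \<noteq> 0"
  using assms unfolding nonzero_pair_def by (metis fst_conv snd_conv fst_zero snd_zero)

lemma simple_imp_generated:
  assumes "simple_lie L" "nonzero_pair P"
  shows "even_part \<subseteq> N.span {br (e x) (e y) | x y. True}" (is "_ \<subseteq> ?TT")
proof
  let ?I = "{a + t | a t. a \<in> ?TT \<and> t \<in> odd_part}"
  have TT: "?TT \<subseteq> even_part"
    by (rule N.span_minimal[OF _ subspace_even]) auto
  have "lie_ideal L ?I"
  proof (rule ideal_via_parity)
    show "N.subspace ?I"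
      using N.subspace_set_sum[OF N.subspace_span subspace_odd] by simp
    show "?I \<subseteq> V" using TT by (auto simp: even_V odd_V subset_iff)
    fix a x assume "x \<in> ?I"
    then obtain b t where x: "x = b + t" "b \<in> ?TT" "t \<in> odd_part" by blast
    then have bt: "b \<in> even_part" "b \<in> V" "t \<in> V" using TT by (auto simp: even_V odd_V)
    obtain v where t: "t = e v" using odd_e[OF x(3)] .
    show "br a x \<in> ?I" if a: "a \<in> even_part"
    proof -
      have "br a b \<in> ?TT"
        using x(2)
      proof (rule span_br_induct)
        fix b assume "b \<in> {br (e x) (e y) | x y. True}"
        then obtain x y where b: "b = br (e x) (e y)" by blast
        show "br a b \<in> ?TT"
          unfolding b br_even_br_e[OF a] by (intro N.span_add N.span_base; blast)
      qed (use a even_V in auto)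
      moreover have "br a t \<in> odd_part" using even_odd[OF a x(3)] .
      moreover have "br a x = br a b + br a t"
        using bt even_V[OF a] by (simp add: x(1) br_add)
      ultimately show ?thesis by blast
    qed
    show "br a x \<in> ?I" if a: "a \<in> odd_part"
    proof -
      obtain u where u: "a = e u" using odd_e[OF a] .
      have "br a t \<in> ?TT" unfolding t u by (rule N.span_base) blast
      moreover have "br a b \<in> odd_part"
        using even_odd[OF bt(1) a] br_anti[of a b] bt odd_V[OF a] N.subspace_neg[OF subspace_odd] by simp
      moreover have "br a x = br a t + br a b"
        using bt odd_V[OF a] by (simp add: x(1) br_add)
      ultimately show ?thesis by blast
    qed
  qed
  then have "?I = {0} \<or> ?I = V" using assms(1) by (simp add: simple_lie_def)
  moreover have "?I \<noteq> {0}"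
  proof -
    obtain v :: "'m \<times> 'p" where "v \<noteq> 0" using nonzero_column[OF assms(2)] .
    have "0 + e v \<in> ?I" using N.span_zero e_odd by blast
    then show ?thesis using \<open>v \<noteq> 0\<close> by (metis add_0 e_eq_0_iff singletonD)
  qed
  ultimately have I: "?I = V" by blast
  fix x assume x: "x \<in> even_part"
  then obtain a t where at: "x = a + t" "a \<in> ?TT" "t \<in> odd_part" using I even_V[OF x] by blast
  \<comment> \<open>Comparing even parts in x = a + t removes t, so x itself lies in the
    span.\<close>
  then have "even_of x = even_of a + even_of t" using TT by (auto simp: even_of_linear even_V odd_V)
  then show "x \<in> ?TT" using at x TT by (auto simp: even_of_even odd_of_odd)
qed

lemma simple_imp_faithful:
  assumes "simple_lie L" "nonzero_pair P" "a \<in> even_part" "\<And>v. br a (e v) = 0"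
  shows "a = 0"
proof -
  let ?Z = "{x \<in> even_part. \<forall>v. br x (e v) = 0}"
  have "lie_ideal L ?Z"
  proof (rule ideal_via_parity)
    show "N.subspace ?Z"
      using subspace_even by (auto simp: N.subspace_def br_add br_scale even_V)
    show "?Z \<subseteq> V" by (auto simp: even_V)
    fix a x assume x: "x \<in> ?Z"
    \<comment> \<open>By Jacobi, [[a,x],T] is contained in [a,[x,T]] + [x,[a,T]]; both vanish
      because [a,T] lies in T again.\<close>
    show "br a x \<in> ?Z" if a: "a \<in> even_part"
      using x a by (simp add: even_even br_jacobi even_V e_act[OF a])
    show "br a x \<in> ?Z" if a: "a \<in> odd_part"
    proof -
      obtain u where "a = e u" using odd_e[OF a] .
      then have "br a x = 0" using x br_anti[of a x] by (simp add: even_V)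
      then show ?thesis using N.subspace_0[OF subspace_even] by simp
    qed
  qed
  then have "?Z = {0} \<or> ?Z = V" using assms(1) by (simp add: simple_lie_def)
  moreover have "?Z \<noteq> V"
  proof
    assume Z: "?Z = V"
    obtain v :: "'m \<times> 'p" where "v \<noteq> 0" using nonzero_column[OF assms(2)] .
    have "e v \<in> even_part" using Z e_V[of v] by blast
    then have "e v = 0" using even_of_even(1)[of "e v"] odd_of_odd(2)[of "e v"] by simp
    then show False using \<open>v \<noteq> 0\<close> by simp
  qed
  ultimately show ?thesis using assms(3,4) by blast
qed

lemma simple_imp_tight:
  assumes "simple_lie L" "nonzero_pair P"
  shows "tight_enveloping L P em ep"
proof unfold_locales
  show "even_part \<subseteq> N.span {br (e x) (e y) | x y. True}"
    by (rule simple_imp_generated[OF assms])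
  show "a = 0" if "a \<in> even_part" "\<And>v. br a (e v) = 0" for a
    by (rule simple_imp_faithful[OF assms that])
qed

end

context tight_enveloping
begin

lemma even_eq_span: "even_part = N.span {br (e x) (e y) | x y. True}"
  by (intro subset_antisym generated N.span_minimal[OF _ subspace_even]) auto

lemma even_induct [consumes 1, case_names br_e zero add scale]:
  assumes "a \<in> even_part" "\<And>x y. Q (br (e x) (e y))" "Q 0"
    "\<And>a b. a \<in> even_part \<Longrightarrow> b \<in> even_part \<Longrightarrow> Q a \<Longrightarrow> Q b \<Longrightarrow> Q (a + b)"
    "\<And>c a. a \<in> even_part \<Longrightarrow> Q a \<Longrightarrow> Q (sc c a)"
  shows "Q a"
proof -
  have "N.subspace {a \<in> even_part. Q a}"
    using assms subspace_even by (auto simp: N.subspace_def)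
  then have "even_part \<subseteq> {a \<in> even_part. Q a}"
    unfolding even_eq_span by (intro N.span_minimal) (use assms(2) even_eq_span in auto)
  then show ?thesis using assms(1) by blast
qed

lemma act_faithful:
  assumes "a \<in> even_part" "b \<in> even_part" "\<And>v. act a v = act b v"
  shows "a = b"
proof -
  have "br (a - b) (e v) = 0" for v
    using assms by (simp add: br_diff even_V e_act)
  then show ?thesis
    using faithful[OF N.subspace_diff[OF subspace_even assms(1,2)]] by simp
qed

lemma act_add: "a \<in> even_part \<Longrightarrow> b \<in> even_part \<Longrightarrow> act (a + b) v = act a v + act b v"
  and act_scale: "a \<in> even_part \<Longrightarrow> act (sc c a) v = col c (act a v)"
  and act_zero: "act 0 v = 0"
  using inv_e[of 0]
  by (simp_all add: act_def[of "a + b"] act_def[of "sc c a"] act_def[of 0] br_add br_scale even_V e_act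
      flip: e_add e_scale)

section \<open>Simplicity\<close>

lemma simple_lie_imp_simple_pair:
  assumes "simple_lie L"
  shows "simple_pair P"
  unfolding simple_pair_def
proof (intro conjI allI impI)
  show "(\<exists>x y z. tm x y z \<noteq> 0) \<or> (\<exists>x y z. tp x y z \<noteq> 0)"
  proof (rule ccontr)
    assume "\<not> ?thesis"
    then have cb0: "cb x y z = 0" for x y z by (simp add: cb_eq prod_eq_iff)
    \<comment> \<open>If all triple products vanish then [T,T] acts as zero on T, hence is zero by
      faithfulness. As [T,T] spans the even part, L = T is abelian, against simplicity.\<close>
    have TT: "br (e x) (e y) = 0" for x y
      by (rule faithful[OF br_e_even]) (simp add: e_triple cb0)
    have even: "a = 0" if "a \<in> even_part" for a
      using that by (induct rule: even_induct) (simp_all add: TT)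
    have "br x y = 0" if "x \<in> V" "y \<in> V" for x y
    proof -
      have "x \<in> odd_part" "y \<in> odd_part"
        using that even_odd_sum[of x] even_odd_sum[of y] odd_of_in[of x] odd_of_in[of y]
          even[OF even_of_in[of x]] even[OF even_of_in[of y]]
        by simp_all
      then obtain u v where "x = e u" "y = e v" using odd_e by metis
      then show ?thesis by (simp add: TT)
    qed
    then show False using assms by (auto simp: simple_lie_def)
  qed
next
  fix Qm Qp assume ideal: "pair_ideal P Qm Qp"
  define Q where "Q = {c. fst c \<in> Qm \<and> snd c \<in> Qp}"
  have sub: "M.subspace Qm" "Q.subspace Qp" using ideal by (simp_all add: pair_ideal_def)
  note subs = M.subspace_0[OF sub(1)] M.subspace_add[OF sub(1)] M.subspace_diff[OF sub(1)]
    M.subspace_scale[OF sub(1)] Q.subspace_0[OF sub(2)] Q.subspace_add[OF sub(2)]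
    Q.subspace_diff[OF sub(2)] Q.subspace_scale[OF sub(2)]
  have Q: "C.subspace Q"
    using subs by (simp add: C.subspace_def Q_def smult_column_def split_beta)
  have absorb: "cb x y q \<in> Q" "cb x q y \<in> Q" if "q \<in> Q" for x y q
    using that ideal subs by (simp_all add: Q_def cb_eq pair_ideal_def absorbs_def)
  \<comment> \<open>Closure of Q under the inner derivations \<open>cb x y\<close> passes to all
    even elements because these are spanned by [T,T].\<close>
  have actQ: "act a q \<in> Q" if "a \<in> even_part" "q \<in> Q" for a q
    using that(1)
    by (induct rule: even_induct)
      (simp_all add: absorb that act_add act_scale act_zero C.subspace_0[OF Q] C.subspace_add[OF Q] C.subspace_scale[OF Q])
  let ?W = "N.span {br (e x) (e q) | x q. q \<in> Q}"
  let ?J = "{e q + w | q w. q \<in> Q \<and> w \<in> ?W}"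
  have eQ: "N.subspace (e ` Q)"
    using Q by (auto simp: N.subspace_def C.subspace_def image_iff e_add[symmetric] e_scale[symmetric])
  have W: "?W \<subseteq> even_part"
    by (rule N.span_minimal[OF _ subspace_even]) auto
  have "lie_ideal L ?J"
  proof (rule ideal_via_parity)
    have "?J = {x + y |x y. x \<in> e ` Q \<and> y \<in> ?W}" by blast
    then show "N.subspace ?J"
      using N.subspace_set_sum[OF eQ N.subspace_span] by simp
    show "?J \<subseteq> V" using W by (auto simp: even_V subset_iff)
    fix a x assume "x \<in> ?J"
    then obtain q w where x: "x = e q + w" "q \<in> Q" "w \<in> ?W" by blast
    then have w: "w \<in> even_part" "w \<in> V" using W by (auto simp: even_V)
    show "br a x \<in> ?J" if a: "a \<in> even_part"
    proof -
      have "br a w \<in> ?W"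
        using x(3)
      proof (rule span_br_induct)
        fix b assume "b \<in> {br (e x) (e q) | x q. q \<in> Q}"
        then obtain x q where b: "b = br (e x) (e q)" "q \<in> Q" by blast
        show "br a b \<in> ?W"
          unfolding b(1) br_even_br_e[OF a]
          using b(2) actQ[OF a b(2)] by (intro N.span_add N.span_base; blast)
      qed (use a even_V in auto)
      moreover have "br a x = e (act a q) + br a w"
        using w even_V[OF a] by (simp add: x(1) br_add e_act[OF a])
      ultimately show ?thesis using actQ[OF a x(2)] by blast
    qed
    show "br a x \<in> ?J" if a: "a \<in> odd_part"
    proof -
      obtain u where u: "a = e u" using odd_e[OF a] .
      have aq: "br a (e q) \<in> ?W" unfolding u using x(2) by (intro N.span_base) blast
      \<comment> \<open>This is [T,[T,Q]] inside Q: absorption by the pair with an element of Q in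
        the middle slot of \<open>cb\<close>.\<close>
      have "br a w \<in> e ` Q"
        using x(3)
      proof (rule span_br_induct)
        fix b assume "b \<in> {br (e x) (e q) | x q. q \<in> Q}"
        then obtain x q where b: "b = br (e x) (e q)" "q \<in> Q" by blast
        have "br a b = - e (cb x q u)"
          using br_anti[of a b] by (simp add: u b e_triple)
        then show "br a b \<in> e ` Q"
          using N.subspace_neg[OF eQ] absorb(2)[OF b(2)] by simp
      qed (use eQ u in auto)
      then obtain r where "br a w = e r" "r \<in> Q" by blast
      moreover have "br a x = br a w + br a (e q)"
        using w odd_V[OF a] by (simp add: x(1) br_add)
      ultimately have "br a x = e r + br a (e q)" "r \<in> Q" by simp_all
      then show ?thesis using aq by blast
    qed
  qed
  then have trivial: "?J = {0} \<or> ?J = V" using assms by (simp add: simple_lie_def)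
  have zero: "q = 0" if "?J = {0}" "q \<in> Q" for q
  proof -
    have "e q + 0 \<in> ?J" using that(2) N.span_zero by blast
    then show ?thesis using that(1) by (metis add.right_neutral e_eq_0_iff singletonD)
  qed
  \<comment> \<open>Since w is even while e v - e q is odd, w vanishes. So an element of J that lies
    in T comes from Q.\<close>
  have full: "v \<in> Q" if J: "?J = V" for v
  proof -
    obtain q w where qw: "e v = e q + w" "q \<in> Q" "w \<in> ?W" using J e_V[of v] by blast
    then have "w \<in> even_part" using W by blast
    moreover have "w = e (v - q)" using qw by (simp add: e_diff)
    ultimately have "w = 0" using even_of_even(1)[of w] odd_of_odd(2)[of w] by simp
    then show ?thesis using qw by simp
  qed
  show "Qm = {0} \<and> Qp = {0} \<or> Qm = UNIV \<and> Qp = UNIV"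
    using trivial
  proof
    assume "?J = {0}"
    note 1 = zero[OF this]
    have "x = 0" if "x \<in> Qm" for x using 1[of "(x, 0)"] that subs by (simp add: Q_def zero_prod_def)
    moreover have "y = 0" if "y \<in> Qp" for y using 1[of "(0, y)"] that subs by (simp add: Q_def zero_prod_def)
    ultimately show ?thesis using subs by blast
  next
    assume "?J = V"
    note 2 = full[OF this]
    have "x \<in> Qm" "y \<in> Qp" for x y using 2[of "(x, y)"] by (simp_all add: Q_def)
    then show ?thesis by blast
  qed
qed

text \<open>Faithfulness in the shape that arguments with lowest terms deliver: brackets from the
  left, with each sign tested separately.\<close>

lemma faithful_hom:
  assumes "a \<in> G i" "even i" "\<And>u. br (em u) a = 0" "\<And>u. br (ep u) a = 0"
  shows "a = 0"
proof (rule faithful)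
  show a: "a \<in> even_part" using assms G_parity by blast
  show "br a (e v) = 0" for v
    using assms(3,4) br_anti[of a "em (fst v)"] br_anti[of a "ep (snd v)"] even_V[OF a]
    by (simp add: e_def br_add)
qed

text \<open>Lowest terms are recorded only in degrees -1 and 1, where P lives. The even degrees are
  recovered from these by \<open>faithful\<close> when the lowest terms vanish, and by
  \<open>generated\<close> when they exhaust P.\<close>

lemma simple_pair_imp_ideal_trivial:
  assumes simple: "simple_pair P" and ideal: "lie_ideal L I"
  shows "I = {0} \<or> I = V"
proof -
  have I: "N.subspace I" "I \<subseteq> V" "\<And>x y. x \<in> V \<Longrightarrow> y \<in> I \<Longrightarrow> br x y \<in> I"
    using ideal by (auto simp: lie_ideal_def)
  note I_closed = N.subspace_0[OF I(1)] N.subspace_add[OF I(1)] N.subspace_diff[OF I(1)]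
    N.subspace_neg[OF I(1)] N.subspace_scale[OF I(1)]
  have I_V: "x \<in> V" if "x \<in> I" for x using I(2) that by blast
  have I_right: "br y x \<in> I" if "x \<in> V" "y \<in> I" for x y
    using br_anti[OF I_V[OF that(2)] that(1)] I(3)[OF that] I_closed(4) by simp
  \<comment> \<open>An element w witnesses its lowest term and may have arbitrary components of
    higher degree; those need not lie in I.\<close>
  define Qm where "Qm = {u. \<exists>w\<in>I. p (-2) w = 0 \<and> p (-1) w = em u}"
  define Qp where "Qp = {u. \<exists>w\<in>I. p (-2) w = 0 \<and> p (-1) w = 0 \<and> p 0 w = 0 \<and> p 1 w = ep u}"
  have QmI: "u \<in> Qm" if "w \<in> I" "p (-2) w = 0" "p (-1) w = em u" for u w
    using that by (auto simp: Qm_def)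
  have QpI: "u \<in> Qp" if "w \<in> I" "p (-2) w = 0" "p (-1) w = 0" "p 0 w = 0" "p 1 w = ep u" for u w
    using that by (auto simp: Qp_def)
  have p_br0: "p i (br (br (em x) (ep y)) w) = br (br (em x) (ep y)) (p i w)"
    "p i (br (br (ep y) (em x)) w) = br (br (ep y) (em x)) (p i w)" if "w \<in> I" for i x y w
    using p_br_hom[OF br_G[OF em_G ep_G refl] I_V[OF that], of i]
      p_br_hom[OF br_G[OF ep_G em_G refl] I_V[OF that], of i] by simp_all
  \<comment> \<open>For u in the first or middle slot the brackets are rearranged so that u is
    innermost. Then u can be replaced by its witness w, whose components are all shifted by the same
    amount.\<close>
  have swap1: "em (tm u y x) = br (em x) (br (ep y) (em u))" "ep (tp u' y' x') = br (ep x') (br (em y') (ep u'))"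
    for u x y u' x' y'
    using br_anti[of "br (em u) (ep y)" "em x"] br_anti[of "em u" "ep y"]
      br_anti[of "br (ep u') (em y')" "ep x'"] br_anti[of "ep u'" "em y'"]
    by (simp_all add: em_triple ep_triple br_minus)
  have swap2: "em (tm x u y) = - br (em y) (br (em x) (ep u))" "ep (tp x' u' y') = - br (ep y') (br (ep x') (em u'))"
    for u x y u' x' y'
    using br_anti[of "br (em x) (ep u)" "em y"] br_anti[of "br (ep x') (em u')" "ep y'"]
    by (simp_all add: em_triple ep_triple)
  note p_hom_simps = p_br_hom[OF em_G] p_br_hom[OF ep_G] I_V I_closed I p_minus p_br0
  have "pair_ideal P Qm Qp"
    unfolding pair_ideal_def absorbs_def
  proof (intro conjI allI ballI)
    show "M.subspace Qm"
    proof (rule M.subspaceI)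
      show "0 \<in> Qm" by (rule QmI[of 0]) (simp_all add: I_closed em_simps)
      fix u v assume "u \<in> Qm" "v \<in> Qm"
      then obtain w w' where "w \<in> I" "p (-2) w = 0" "p (-1) w = em u"
        "w' \<in> I" "p (-2) w' = 0" "p (-1) w' = em v" by (auto simp: Qm_def)
      then show "u + v \<in> Qm"
        by (intro QmI[of "w + w'"]) (simp_all add: I_closed em_simps p_add I_V)
    next
      fix c u assume "u \<in> Qm"
      then obtain w where "w \<in> I" "p (-2) w = 0" "p (-1) w = em u" by (auto simp: Qm_def)
      then show "sm c u \<in> Qm"
        by (intro QmI[of "sc c w"]) (simp_all add: I_closed em_simps p_scale I_V)
    qed
    show "Q.subspace Qp"
    proof (rule Q.subspaceI)
      show "0 \<in> Qp" by (rule QpI[of 0]) (simp_all add: I_closed ep_simps)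
      fix u v assume "u \<in> Qp" "v \<in> Qp"
      then obtain w w' where "w \<in> I" "p (-2) w = 0" "p (-1) w = 0" "p 0 w = 0" "p 1 w = ep u"
        "w' \<in> I" "p (-2) w' = 0" "p (-1) w' = 0" "p 0 w' = 0" "p 1 w' = ep v" by (auto simp: Qp_def)
      then show "u + v \<in> Qp"
        by (intro QpI[of "w + w'"]) (simp_all add: I_closed ep_simps p_add I_V)
    next
      fix c u assume "u \<in> Qp"
      then obtain w where "w \<in> I" "p (-2) w = 0" "p (-1) w = 0" "p 0 w = 0" "p 1 w = ep u"
        by (auto simp: Qp_def)
      then show "sp c u \<in> Qp"
        by (intro QpI[of "sc c w"]) (simp_all add: I_closed ep_simps p_scale I_V)
    qed
    fix x :: 'm and y :: 'p and u assume "u \<in> Qm"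
    then obtain w where w: "w \<in> I" "p (-2) w = 0" "p (-1) w = em u" by (auto simp: Qm_def)
    show "tm x y u \<in> Qm"
      by (rule QmI[of "br (br (em x) (ep y)) w"]) (simp_all add: w p_hom_simps em_triple ep_triple)
    show "tm u y x \<in> Qm"
      by (rule QmI[of "br (em x) (br (ep y) w)"]) (simp_all add: w p_hom_simps swap1)
  next
    fix x y :: 'p and u assume "u \<in> Qm"
    then obtain w where w: "w \<in> I" "p (-2) w = 0" "p (-1) w = em u" by (auto simp: Qm_def)
    \<comment> \<open>Two factors of degree 1 raise degrees by 2, so a witness starting in degree -1
      yields one starting in degree 1. This supplies all the vanishing conditions in
      \<open>Qp\<close>.\<close>
    show "tp x u y \<in> Qp"
      by (rule QpI[of "- br (ep y) (br (ep x) w)"]) (simp_all add: w p_hom_simps swap2)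
  next
    fix x :: 'p and y :: 'm and u assume "u \<in> Qp"
    then obtain w where w: "w \<in> I" "p (-2) w = 0" "p (-1) w = 0" "p 0 w = 0" "p 1 w = ep u"
      by (auto simp: Qp_def)
    show "tp x y u \<in> Qp"
      by (rule QpI[of "br (br (ep x) (em y)) w"]) (simp_all add: w p_hom_simps em_triple ep_triple)
    show "tp u y x \<in> Qp"
      by (rule QpI[of "br (ep x) (br (em y) w)"]) (simp_all add: w p_hom_simps swap1)
  next
    fix x y :: 'm and u assume "u \<in> Qp"
    then obtain w where w: "w \<in> I" "p (-2) w = 0" "p (-1) w = 0" "p 0 w = 0" "p 1 w = ep u"
      by (auto simp: Qp_def)
    \<comment> \<open>Here w starts in degree 1, so lowering by 2 leaves nothing below degree
      -1.\<close>
    show "tm x u y \<in> Qm"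
      by (rule QmI[of "- br (em y) (br (em x) w)"]) (simp_all add: w p_hom_simps swap2)
  qed
  then have "(Qm = {0} \<and> Qp = {0}) \<or> (Qm = UNIV \<and> Qp = UNIV)"
    using simple by (simp add: simple_pair_def)
  then show ?thesis
  proof
    assume Q: "Qm = {0} \<and> Qp = {0}"
    have m: "p (-1) w = 0" if w: "w \<in> I" "p (-2) w = 0" for w
    proof -
      obtain u where u: "p (-1) w = em u" using G_m1E[OF p_in[OF I_V[OF w(1)]]] .
      then show ?thesis using QmI[OF w u] Q by (simp add: em_simps)
    qed
    have pl: "p 1 w = 0" if w: "w \<in> I" "p (-2) w = 0" "p (-1) w = 0" "p 0 w = 0" for w
    proof -
      obtain u where u: "p 1 w = ep u" using G_1E[OF p_in[OF I_V[OF w(1)]]] .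
      then show ?thesis using QpI[OF w u] Q by (simp add: ep_simps)
    qed
    have "x = 0" if x: "x \<in> I" for x
    proof -
      note xV = I_V[OF x]
      have emI: "br (em u) x \<in> I" and epI: "br (ep u') x \<in> I" for u u' using I(3) x by simp_all
      note pe = p_br_hom[OF em_G xV] p_br_hom[OF ep_G xV]
      have out: "br (em u) (p (-2) x) = 0" "br (ep u') (p 2 x) = 0" for u u'
        by (rule G_zero[OF _ br_G[OF em_G p_in[OF xV] refl]], simp,
          rule G_zero[OF _ br_G[OF ep_G p_in[OF xV] refl]], simp)
      \<comment> \<open>A bracket with \<open>ep\<close> moves p (-2) x to degree -1, the lowest
        term of an element of I, which \<open>m\<close> kills; a bracket with \<open>em\<close>
        moves it to degree -3. The later components are removed in the same way, in increasing order
        of degree, using \<open>pl\<close> for lowest terms in degree 1.\<close>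
      have x_m2: "p (-2) x = 0"
        using m[OF epI] xV by (intro faithful_hom[OF p_in[OF xV]] out) (simp_all add: pe)
      have x_m1: "p (-1) x = 0" using m[OF x x_m2] .
      have x_0: "p 0 x = 0"
        using m[OF emI] pl[OF epI] xV by (intro faithful_hom[OF p_in[OF xV]]) (simp_all add: pe x_m2 x_m1)
      have x_1: "p 1 x = 0" using pl[OF x x_m2 x_m1 x_0] .
      have x_2: "p 2 x = 0"
        using pl[OF emI] xV by (intro faithful_hom[OF p_in[OF xV]] out) (simp_all add: pe x_m2 x_m1 x_0 x_1)
      show ?thesis using p_sum[OF xV] x_m2 x_m1 x_0 x_1 x_2 by simp
    qed
    then show ?thesis using I_closed(1) by blast
  next
    assume Q: "Qm = UNIV \<and> Qp = UNIV"
    \<comment> \<open>The recovery runs from the top down. A witness w of ep (snd y) has only one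
      further component, in degree 2, and bracketing that with \<open>ep\<close> gives degree 3, so
      [ep (snd x), ep (snd y)] equals [ep (snd x), w].\<close>
    have p2: "p 2 a \<in> I" if "a \<in> even_part" for a
      using that
    proof (induct rule: even_induct)
      case (br_e x y)
      obtain w where w: "w \<in> I" "p (-2) w = 0" "p (-1) w = 0" "p 0 w = 0" "p 1 w = ep (snd y)"
        using Q by (auto simp: Qp_def)
      have out: "br (ep (snd x)) (p 2 w) = 0"
        by (rule G_zero[OF _ br_G[OF ep_G p_in[OF I_V[OF w(1)]] refl]]) simp
      have "p 2 (br (e x) (e y)) = br (ep (snd x)) (ep (snd y))"
        by (simp add: p_br p_e)
      also have "\<dots> = br (ep (snd x)) w"
        using p_sum[OF I_V[OF w(1)]] w out I_V[OF w(1)] br_add(1)[of "ep (snd x)" "ep (snd y)" "p 2 w"] by simp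
      finally show ?case using I(3) w(1) by simp
    qed (simp_all add: I_closed p_add p_scale even_V)
    have p2': "p 2 w \<in> I" if "w \<in> I" for w
      using p2[OF G_parity(1)[OF p_in[OF I_V[OF that], of 2]]] I_V[OF that] by (simp add: p_p)
    have ep: "ep u \<in> I" for u
    proof -
      obtain w where w: "w \<in> I" "p (-2) w = 0" "p (-1) w = 0" "p 0 w = 0" "p 1 w = ep u"
        using Q by (auto simp: Qp_def)
      have "ep u = w - p 2 w" using p_sum[OF I_V[OF w(1)]] w by (simp add: algebra_simps)
      then show ?thesis using I_closed p2' w by simp
    qed
    \<comment> \<open>The degree 0 component of [e x, e y] is a sum of two brackets, each having a
      factor \<open>ep u\<close> already known to be in I.\<close>
    have p0: "p 0 a \<in> I" if "a \<in> even_part" for a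
      using that
      by (induct rule: even_induct)
        (simp_all add: I_closed p_add p_scale even_V p_br p_e I(3) I_right ep)
    have p0': "p 0 w \<in> I" if "w \<in> I" for w
      using p0[OF G_parity(1)[OF p_in[OF I_V[OF that], of 0]]] I_V[OF that] by (simp add: p_p)
    have em: "em u \<in> I" for u
    proof -
      obtain w where w: "w \<in> I" "p (-2) w = 0" "p (-1) w = em u"
        using Q by (auto simp: Qm_def)
      obtain u' where u': "p 1 w = ep u'" using G_1E[OF p_in[OF I_V[OF w(1)]]] .
      have "em u = w - p 0 w - ep u' - p 2 w" using p_sum[OF I_V[OF w(1)]] w u' by (simp add: algebra_simps)
      then show ?thesis using I_closed p2' p0' ep w by simp
    qed
    have eI: "e v \<in> I" for v using em ep I_closed by (simp add: e_def)
    have evI: "a \<in> I" if "a \<in> even_part" for a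
      using that by (induct rule: even_induct) (simp_all add: I_closed I(3) eI)
    have "x \<in> I" if x: "x \<in> V" for x
    proof -
      obtain v where "odd_of x = e v" using odd_e[OF odd_of_in[OF x]] .
      then show ?thesis using evI[OF even_of_in[OF x]] eI[of v] I_closed even_odd_sum[OF x] by metis
    qed
    then show ?thesis using I(2) by blast
  qed
qed

lemma simple_pair_imp_simple_lie:
  assumes "simple_pair P"
  shows "simple_lie L"
proof -
  have "\<exists>x\<in>V. \<exists>y\<in>V. br x y \<noteq> 0"
  proof (rule ccontr)
    assume "\<not> ?thesis"
    then have "br x y = 0" if "x \<in> V" "y \<in> V" for x y using that by blast
    then have "em (tm x y z) = 0" "ep (tp y x y') = 0" for x y z y'
      by (simp_all add: em_triple ep_triple)
    then show False using assms by (simp add: simple_pair_def em_eq_0_iff ep_eq_0_iff)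
  qed
  then show ?thesis
    using simple_pair_imp_ideal_trivial[OF assms] by (simp add: simple_lie_def)
qed

end

section \<open>The isomorphism with the Kantor Lie algebra\<close>

context kantor_pair_loc
begin

lemma shifts_comp: "shifts i A \<Longrightarrow> shifts j B \<Longrightarrow> shifts (i + j) (A \<circ> B)"
  by (simp add: shifts_def del: split_paired_All) (metis add.assoc add.commute)

lemma subspace_grade: "L.subspace (grade (kantor_lie P) i)"
  using A.subspace_0[OF subspace_shifts] A.subspace_add[OF subspace_shifts]
    A.subspace_scale[OF subspace_shifts] C.subspace_0[OF subspace_column_grade]
    C.subspace_add[OF subspace_column_grade] C.subspace_scale[OF subspace_column_grade]
  unfolding L.subspace_def kantor_grade by (auto simp: kantor_simps zero_prod_def)

lemma bracket_grade:
  assumes "x \<in> grade (kantor_lie P) i" "y \<in> grade (kantor_lie P) j"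
  shows "bracket (kantor_lie P) x y \<in> grade (kantor_lie P) (i + j)"
proof -
  obtain A h B k where xy: "x = (A, h)" "y = (B, k)" by (metis surj_pair)
  then have AB: "A \<in> kantor_S P" "shifts i A" "h \<in> column_grade i"
    "B \<in> kantor_S P" "shifts j B" "k \<in> column_grade j" using assms by (simp_all add: kantor_grade)
  have "shifts (i + j) (A \<circ> B)" "shifts (i + j) (B \<circ> A)"
    using shifts_comp[OF AB(2,5)] shifts_comp[OF AB(5,2)] by (simp_all add: add.commute)
  then have "shifts (i + j) ((A \<circ> B) - (B \<circ> A))"
    using C.subspace_diff[OF subspace_column_grade] by (simp add: shifts_def)
  then have "(A \<circ> B) - (B \<circ> A) + cb h k \<in> {A \<in> kantor_S P. shifts (i + j) A}"
    by (intro A.subspace_add[OF subspace_shifts])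
      (simp_all add: S_commutator AB cb_in_S shifts_cb)
  moreover have "A k \<in> column_grade (i + j)" "B h \<in> column_grade (i + j)"
    using AB unfolding shifts_def by (metis add.commute, blast)
  then have "A k - B h \<in> column_grade (i + j)"
    by (rule C.subspace_diff[OF subspace_column_grade])
  ultimately show ?thesis by (simp add: xy kantor_simps kantor_grade)
qed

lemma five_graded_kantor: "five_graded_lie_algebra (kantor_lie P)"
proof -
  let ?G = "grade (kantor_lie P)"
  have zero: "?G i = {0}" if "\<bar>i\<bar> > 2" for i
    using that by (auto simp: kantor_lie_def)
  have "\<exists>!c. (\<forall>i. c i \<in> ?G i) \<and> finite {i. c i \<noteq> 0} \<and> x = (\<Sum>i | c i \<noteq> 0. c i)"
    if x: "x \<in> carrier (kantor_lie P)" for x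
  proof (rule unique_decomposition)
    show "\<And>i x y. x \<in> ?G i \<Longrightarrow> y \<in> ?G i \<Longrightarrow> x - y \<in> ?G i"
      by (rule L.subspace_diff[OF subspace_grade])
    show "\<And>i. \<bar>i\<bar> > 2 \<Longrightarrow> ?G i = {0}" by (rule zero)
    obtain A u v where x': "x = (A, (u, v))" by (metis surj_pair)
    with x obtain B C D where d: "B \<in> kantor_S P" "shifts (-2) B" "C \<in> kantor_S0 P" "D \<in> kantor_S P"
      "shifts 2 D" "A = B + C + D"
      using S_decompose[of A] by (auto simp: kantor_simps)
    \<comment> \<open>The matrix supplies the components of even degree by
      \<open>S_decompose\<close>, and the two entries of the column supply those of odd
      degree.\<close>
    define c where "c = (\<lambda>i::int. if i = -2 then (B, 0) else if i = -1 then (0, (u, 0))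
      else if i = 0 then (C, 0) else if i = 1 then (0, (0, v)) else if i = 2 then (D, 0) else 0)"
    have S0: "0 \<in> kantor_S P" "shifts i 0" "0 \<in> column_grade i" for i
      using A.subspace_0[OF subspace_S] by (simp_all add: column_grade_def shifts_def)
    have "c i \<in> ?G i" for i
      using d S0 by (cases i rule: five_cases) (auto simp: c_def kantor_grade S0_eq column_grade_eqs zero_prod_def)
    moreover have "x = five_sum c" by (simp add: c_def x' d)
    ultimately show "\<exists>c. (\<forall>i. c i \<in> ?G i) \<and> x = five_sum c" by blast
  next
    fix c i assume c: "\<forall>i. c i \<in> ?G i" and sum: "five_sum c = 0"
    have ci: "fst (c i) \<in> kantor_S P" "shifts i (fst (c i))" "snd (c i) \<in> column_grade i" for i
      using c[rule_format, of i] by (auto simp: kantor_grade)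
    have f: "fst (c (-1)) = 0" "fst (c 1) = 0"
      using shifts_trivial[OF ci(1,2)] by simp_all
    have s: "snd (c (-2)) = 0" "snd (c 0) = 0" "snd (c 2) = 0"
      "snd (snd (c (-1))) = 0" "fst (snd (c 1)) = 0"
      using ci(3)[of "-2"] ci(3)[of 0] ci(3)[of 2] ci(3)[of 1] ci(3)[of "-1"] by (simp_all add: column_grade_def prod_eq_iff)
    have "fst (c (-2)) + fst (c 0) + fst (c 2) = 0"
      using arg_cong[OF sum, of fst] f by simp
    from shifts_independent[OF ci(1,2) ci(1,2) ci(1,2) this]
    have "fst (c (-2)) = 0" "fst (c 0) = 0" "fst (c 2) = 0" .
    moreover have "snd (c (-1)) = 0" "snd (c 1) = 0"
      using arg_cong[OF sum, of "\<lambda>x. fst (snd x)"] arg_cong[OF sum, of "\<lambda>x. snd (snd x)"] s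
      by (simp_all add: prod_eq_iff)
    ultimately show "c i = 0"
      using f s c zero[of i] by (cases i rule: five_cases) (auto simp: prod_eq_iff)
  qed
  moreover have "?G i \<subseteq> carrier (kantor_lie P)" for i
    by (auto simp: kantor_grade kantor_simps)
  ultimately show ?thesis
    using lie_kantor subspace_grade bracket_grade zero
    by (simp add: five_graded_lie_algebra_def graded_lie_algebra_def)
qed

lemma envelops_kantor: "envelops (kantor_lie P) P kantor_minus kantor_plus"
  unfolding envelops_def
proof (intro conjI allI)
  have m: "mat a 0 = 0" for a by (rule A.scale_zero_right)
  show "module_hom sm (smult (kantor_lie P)) kantor_minus"
    by unfold_locales (simp_all add: kantor_minus_def kantor_simps m smult_column_def)
  show "module_hom sp (smult (kantor_lie P)) kantor_plus"
    by unfold_locales (simp_all add: kantor_plus_def kantor_simps m smult_column_def)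
  show "bij_betw kantor_minus UNIV (grade (kantor_lie P) (-1))"
    by (auto simp: kantor_lie_def kantor_minus_def bij_betw_def inj_def)
  show "bij_betw kantor_plus UNIV (grade (kantor_lie P) 1)"
    by (auto simp: kantor_lie_def kantor_plus_def bij_betw_def inj_def)
  have c: "(A \<circ> 0) - (0 \<circ> A) = 0" if "A \<in> kantor_S P" for A
    using S_zero[OF that] by (simp add: fun_eq_iff)
  have z: "(0, 0) = (0 :: 'm \<times> 'p)" by (simp add: zero_prod_def)
  show "kantor_minus (tm x y w) = bracket (kantor_lie P) (bracket (kantor_lie P) (kantor_minus x) (kantor_plus y)) (kantor_minus w)" for x y w
    by (simp add: kantor_minus_def kantor_plus_def kantor_simps c[OF cb_in_S] c[OF A.subspace_0[OF subspace_S]]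
      cb_homogeneous tm_simps tp_simps del: minus_apply)
  show "kantor_plus (tp x y w) = bracket (kantor_lie P) (bracket (kantor_lie P) (kantor_plus x) (kantor_minus y)) (kantor_plus w)" for x y w
    by (simp add: kantor_minus_def kantor_plus_def kantor_simps c[OF cb_in_S] c[OF A.subspace_0[OF subspace_S]]
      cb_homogeneous tm_simps tp_simps)
qed

lemma enveloping_kantor: "enveloping (kantor_lie P) P kantor_minus kantor_plus"
  by unfold_locales (rule five_graded_kantor, rule envelops_kantor)

text \<open>Both properties are built in: [(0,x),(0,y)] = (cb x y, 0) and these matrices span S(P),
  while [(A,0),(0,v)] = (0, A v) and a matrix is a function, hence zero if all its values
  are.\<close>

lemma tight_enveloping_kantor: "tight_enveloping (kantor_lie P) P kantor_minus kantor_plus"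
proof -
  interpret K: enveloping "kantor_lie P" P kantor_minus kantor_plus
    by (rule enveloping_kantor)
  have e: "K.e v = (0, v)" for v
    by (simp add: K.e_def kantor_minus_def kantor_plus_def)
  have even: "snd x = 0" if "x \<in> K.even_part" for x
  proof -
    have "snd (K.p i x) \<in> column_grade i" for i
      using K.p_in[OF K.even_V[OF that], of i] by (auto simp: kantor_grade)
    from this[of "-2"] this[of 0] this[of 2]
    have "snd (K.p (-2) x + K.p 0 x + K.p 2 x) = 0" by (simp add: column_grade_eqs)
    then show ?thesis using K.even_of_even(1)[OF that] by (simp only: K.even_of_def)
  qed
  have br: "K.br (K.e x) (K.e y) = (cb x y, 0)" for x y
    by (simp add: e kantor_simps fun_eq_iff)
  show ?thesis
  proof unfold_locales
    let ?B = "{K.br (K.e x) (K.e y) |x y. True}"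
    show "K.even_part \<subseteq> L.span ?B"
    proof
      fix x assume x: "x \<in> K.even_part"
      then obtain A where A: "x = (A, 0)" "A \<in> kantor_S P"
        using even[OF x] K.even_V[OF x] by (cases x) (auto simp: kantor_simps)
      have "(A, 0) \<in> L.span ?B" using A(2)
      proof (induct rule: kantor_S_induct)
        case (cb x y)
        show ?case unfolding br[symmetric] by (rule L.span_base) blast
      next
        case zero
        show ?case
          using L.span_zero[of ?B] unfolding zero_prod_def[where 'a = "'m \<times> 'p \<Rightarrow> 'm \<times> 'p"] .
      next
        case (add A B)
        from L.span_add[OF this] show ?case unfolding add_Pair add_0_right .
      next
        case (scale a A)
        from L.span_scale[OF this, of a] show ?case unfolding kantor_simps C.scale_zero_right .
      qed
      then show "x \<in> L.span ?B" using A by simp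
    qed
    fix x assume x: "x \<in> K.even_part" and 0: "\<And>v. K.br x (K.e v) = 0"
    obtain A where A: "x = (A, 0)" using even[OF x] by (cases x) auto
    have "A v = 0" for v using arg_cong[OF 0[of v], of snd] by (simp add: A e kantor_simps)
    then show "x = 0" by (simp add: A prod_eq_iff fun_eq_iff)
  qed
qed

end

section \<open>Construction and uniqueness of the isomorphism\<close>

context tight_enveloping
begin

lemma act_add_op: "a \<in> even_part \<Longrightarrow> b \<in> even_part \<Longrightarrow> act (a + b) = act a + act b"
  and act_scale_op: "a \<in> even_part \<Longrightarrow> act (sc c a) = mat c (act a)"
  and act_zero_op: "act 0 = 0"
  by (simp_all add: fun_eq_iff act_add act_scale act_zero mat_apply)

lemma act_in_S: "a \<in> even_part \<Longrightarrow> act a \<in> kantor_S P"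
  by (induct rule: even_induct)
    (simp_all only: act_br_e cb_in_S act_add_op act_scale_op act_zero_op A.subspace_0[OF subspace_S]
      A.subspace_add[OF subspace_S] A.subspace_scale[OF subspace_S])

lemma act_surj: "A \<in> kantor_S P \<Longrightarrow> \<exists>a\<in>even_part. act a = A"
proof (induct rule: kantor_S_induct)
  case (cb x y)
  show ?case using act_br_e br_e_even by blast
next
  case zero
  show ?case using act_zero_op N.subspace_0[OF subspace_even] by blast
next
  case (add A B)
  then obtain a b where "a \<in> even_part" "act a = A" "b \<in> even_part" "act b = B" by blast
  then show ?case using act_add_op[of a b] N.subspace_add[OF subspace_even, of a b] by metis
next
  case (scale c A)
  then obtain a where "a \<in> even_part" "act a = A" by blast
  then show ?case using act_scale_op[of a c] N.subspace_scale[OF subspace_even, of a c] by metis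
qed

lemma act_br:
  assumes "a \<in> even_part" "b \<in> even_part"
  shows "act (br a b) = (act a \<circ> act b) - (act b \<circ> act a)"
proof
  fix v
  have "br (br a b) (e v) = e (act a (act b v) - act b (act a v))"
    using assms by (simp add: br_jacobi even_V e_act e_diff)
  then show "act (br a b) v = ((act a \<circ> act b) - (act b \<circ> act a)) v"
    by (simp add: act_def[of "br a b"])
qed

lemma column_grade_iff: "h \<in> column_grade k \<longleftrightarrow> e h \<in> G k"
proof
  assume h: "h \<in> column_grade k"
  consider "k = -1" | "k = 1" | "h = 0" using h by (auto simp: column_grade_def prod_eq_iff)
  then show "e h \<in> G k"
    using h by cases (simp_all add: column_grade_def e_def em_simps ep_simps)
next
  assume h: "e h \<in> G k"
  show "h \<in> column_grade k"
    using p_hom[OF h, of "-1"] p_hom[OF h, of 1]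
    by (auto simp: column_grade_def p_e em_eq_0_iff ep_eq_0_iff split: if_splits)
qed

text \<open>The even part goes to the matrices by which it acts and T to its columns. Restricting to
  V fixes the value outside the carrier, so that uniqueness can be stated for functions.\<close>

definition to_kantor :: "'l \<Rightarrow> ('m, 'p) kantor_space" where
  "to_kantor = (\<lambda>x\<in>V. (act (even_of x), inv e (odd_of x)))"

lemma to_kantor_sum: "a \<in> even_part \<Longrightarrow> to_kantor (a + e v) = (act a, v)"
  by (simp add: to_kantor_def even_V even_of_linear odd_of_linear even_of_even odd_of_odd)

lemma V_cases: assumes "x \<in> V" obtains a v where "a \<in> even_part" "x = a + e v"
  using assms even_of_in odd_of_in even_odd_sum odd_e by metis

lemma to_kantor_add: "x \<in> V \<Longrightarrow> y \<in> V \<Longrightarrow> to_kantor (x + y) = to_kantor x + to_kantor y"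
  and to_kantor_scale: "x \<in> V \<Longrightarrow> to_kantor (sc c x) = smult (kantor_lie P) c (to_kantor x)"
proof -
  assume x: "x \<in> V"
  obtain a v where av: "a \<in> even_part" "x = a + e v" using V_cases[OF x] .
  have "sc c x = sc c a + e (col c v)" by (simp add: av e_scale N.scale_right_distrib)
  then show "to_kantor (sc c x) = smult (kantor_lie P) c (to_kantor x)"
    using av N.subspace_scale[OF subspace_even av(1)]
    by (simp add: to_kantor_sum act_scale_op kantor_simps)
  assume y: "y \<in> V"
  obtain b w where bw: "b \<in> even_part" "y = b + e w" using V_cases[OF y] .
  have "x + y = (a + b) + e (v + w)" by (simp add: av bw e_add)
  then have "to_kantor (x + y) = (act (a + b), v + w)"
    using to_kantor_sum[OF N.subspace_add[OF subspace_even av(1) bw(1)]] by (simp only:)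
  moreover have "to_kantor x = (act a, v)" "to_kantor y = (act b, w)"
    using av bw by (simp_all add: to_kantor_sum)
  ultimately show "to_kantor (x + y) = to_kantor x + to_kantor y"
    using av(1) bw(1) by (simp add: act_add_op)
qed

lemma br_sum:
  assumes "a \<in> even_part" "b \<in> even_part"
  shows "br (a + e v) (b + e w) = (br a b + br (e v) (e w)) + e (act a w - act b v)"
    and "br a b + br (e v) (e w) \<in> even_part"
  using br_anti[of "e v" b] assms N.subspace_add[OF subspace_even even_even br_e_even]
  by (simp_all add: br_add even_V e_act e_diff)

lemma to_kantor_br:
  assumes x: "x \<in> V" and y: "y \<in> V"
  shows "to_kantor (br x y) = bracket (kantor_lie P) (to_kantor x) (to_kantor y)"
proof -
  obtain a v where av: "a \<in> even_part" "x = a + e v" using V_cases[OF x] .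
  obtain b w where bw: "b \<in> even_part" "y = b + e w" using V_cases[OF y] .
  have "to_kantor (br x y) = (act (br a b + br (e v) (e w)), act a w - act b v)"
    unfolding av(2) bw(2) br_sum(1)[OF av(1) bw(1)] by (rule to_kantor_sum[OF br_sum(2)[OF av(1) bw(1)]])
  moreover have "to_kantor x = (act a, v)" "to_kantor y = (act b, w)"
    using av bw by (simp_all add: to_kantor_sum)
  ultimately show ?thesis
    using av(1) bw(1) by (simp add: kantor_simps act_add_op even_even act_br)
qed

lemma to_kantor_grade: "x \<in> G i \<Longrightarrow> to_kantor x \<in> grade (kantor_lie P) i"
proof (cases "even i")
  case True
  assume x: "x \<in> G i"
  have xe: "x \<in> even_part" using G_parity(1)[OF x True] .
  have "act x h \<in> column_grade (k + i)" if "h \<in> column_grade k" for h k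
    using br_G[OF x that[unfolded column_grade_iff] add.commute] by (simp add: column_grade_iff e_act[OF xe])
  then have "shifts i (act x)" by (simp add: shifts_def)
  then show ?thesis
    using to_kantor_sum[OF xe, of 0] act_in_S[OF xe] C.subspace_0[OF subspace_column_grade, of i] by (simp add: kantor_grade)
next
  case False
  assume x: "x \<in> G i"
  then obtain v where v: "x = e v" using odd_e G_parity(2)[OF x False] by blast
  then show ?thesis
    using x to_kantor_sum[OF N.subspace_0[OF subspace_even], of v] A.subspace_0[OF subspace_shifts, of i]
    by (simp add: kantor_grade column_grade_iff act_zero_op)
qed

lemma bij_to_kantor: "bij_betw to_kantor V (carrier (kantor_lie P))"
proof (rule bij_betw_imageI)
  show "inj_on to_kantor V"
  proof (rule inj_onI)
    fix x y assume x: "x \<in> V" and y: "y \<in> V" and eq: "to_kantor x = to_kantor y"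
    obtain a v where av: "a \<in> even_part" "x = a + e v" using V_cases[OF x] .
    obtain b w where bw: "b \<in> even_part" "y = b + e w" using V_cases[OF y] .
    have "act a = act b" "v = w" using eq av bw by (simp_all add: to_kantor_sum)
    then show "x = y" using act_faithful[OF av(1) bw(1)] av bw by simp
  qed
  show "to_kantor ` V = carrier (kantor_lie P)"
  proof (rule set_eqI, rule iffI)
    fix y assume "y \<in> to_kantor ` V"
    then obtain x where x: "x \<in> V" "y = to_kantor x" by blast
    obtain a v where av: "a \<in> even_part" "x = a + e v" using V_cases[OF x(1)] .
    then show "y \<in> carrier (kantor_lie P)" using x by (simp add: to_kantor_sum kantor_simps act_in_S)
  next
    fix y assume "y \<in> carrier (kantor_lie P)"
    then obtain A v where y: "y = (A, v)" "A \<in> kantor_S P" by (cases y) (simp add: kantor_simps)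
    then obtain a where "a \<in> even_part" "act a = A" using act_surj by blast
    then show "y \<in> to_kantor ` V"
      by (intro image_eqI[of _ _ "a + e v"]) (simp_all add: y to_kantor_sum even_V)
  qed
qed

lemma graded_isomorphism_to_kantor: "graded_isomorphism L (kantor_lie P) to_kantor"
  unfolding graded_isomorphism_def
proof (intro conjI allI ballI)
  show "bij_betw to_kantor V (carrier (kantor_lie P))" by (rule bij_to_kantor)
  then have in_carrier: "to_kantor x \<in> carrier (kantor_lie P)" if "x \<in> V" for x
    using that by (auto simp: bij_betw_def)
  show "linear_between sc V (smult (kantor_lie P)) (carrier (kantor_lie P)) to_kantor"
    using in_carrier by (simp add: linear_between_def to_kantor_add to_kantor_scale)
  show "to_kantor (br x y) = bracket (kantor_lie P) (to_kantor x) (to_kantor y)"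
    if "x \<in> V" "y \<in> V" for x y using to_kantor_br[OF that] .
  interpret K: five_graded "kantor_lie P" by unfold_locales (rule five_graded_kantor)
  fix i
  show "to_kantor ` G i = grade (kantor_lie P) i"
  proof
    show "to_kantor ` G i \<subseteq> grade (kantor_lie P) i" using to_kantor_grade by blast
    show "grade (kantor_lie P) i \<subseteq> to_kantor ` G i"
    proof
      fix y assume y: "y \<in> grade (kantor_lie P) i"
      then obtain x where x: "x \<in> V" "y = to_kantor x"
        using bij_to_kantor K.G_subset[OF y] by (auto simp: bij_betw_def)
      \<comment> \<open>The preimage x is not yet known to be homogeneous. Projecting y onto degree
        i shows that p i x is a preimage as well.\<close>
      have "to_kantor x = five_sum (\<lambda>j. to_kantor (p j x))"
        using x(1) by (subst p_sum[OF x(1), symmetric]) (simp only: to_kantor_add V_closed p_V)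
      then have "K.p i y = to_kantor (p i x)"
        unfolding x(2) using x(1) to_kantor_grade by (intro K.p_unique) auto
      then have "y = to_kantor (p i x)" using K.p_hom[OF y, of i] by simp
      then show "y \<in> to_kantor ` G i" using x(1) by blast
    qed
  qed
qed

lemma to_kantor_em: "to_kantor (em x) = kantor_minus x" and to_kantor_ep: "to_kantor (ep y) = kantor_plus y"
  using to_kantor_sum[OF N.subspace_0[OF subspace_even], of "(x, 0)"]
    to_kantor_sum[OF N.subspace_0[OF subspace_even], of "(0, y)"]
  by (simp_all add: e_def em_simps ep_simps act_zero_op kantor_minus_def kantor_plus_def)

text \<open>A homomorphism that is prescribed on T is determined on [T,T], hence on all of
  L.\<close>

lemma unique_isomorphism:
  "\<exists>!\<phi>. \<phi> \<in> extensional V \<and> graded_isomorphism L (kantor_lie P) \<phi> \<and>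
      (\<forall>x. \<phi> (em x) = kantor_minus x) \<and> (\<forall>x. \<phi> (ep x) = kantor_plus x)"
proof (rule ex1I[of _ to_kantor], intro conjI)
  show "to_kantor \<in> extensional V" by (simp add: to_kantor_def)
  fix \<psi> assume "\<psi> \<in> extensional V \<and> graded_isomorphism L (kantor_lie P) \<psi> \<and>
      (\<forall>x. \<psi> (em x) = kantor_minus x) \<and> (\<forall>x. \<psi> (ep x) = kantor_plus x)"
  then have ext: "\<psi> \<in> extensional V"
    and add: "\<And>x y. x \<in> V \<Longrightarrow> y \<in> V \<Longrightarrow> \<psi> (x + y) = \<psi> x + \<psi> y"
    and scale: "\<And>c x. x \<in> V \<Longrightarrow> \<psi> (sc c x) = smult (kantor_lie P) c (\<psi> x)"
    and hom: "\<And>x y. x \<in> V \<Longrightarrow> y \<in> V \<Longrightarrow> \<psi> (br x y) = bracket (kantor_lie P) (\<psi> x) (\<psi> y)"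
    and gen: "\<And>x. \<psi> (em x) = kantor_minus x" "\<And>x. \<psi> (ep x) = kantor_plus x"
    by (simp_all add: graded_isomorphism_def linear_between_def)
  have e: "\<psi> (e v) = to_kantor (e v)" for v
    by (simp add: e_def add gen to_kantor_add to_kantor_em to_kantor_ep)
  have even: "\<psi> a = to_kantor a" if "a \<in> even_part" for a
    using that
  proof (induct rule: even_induct)
    case (br_e x y)
    show ?case by (simp add: hom to_kantor_br e)
  next
    case zero
    show ?case using e[of 0] by simp
  qed (simp_all add: add scale even_V to_kantor_add to_kantor_scale)
  show "\<psi> = to_kantor"
  proof (rule extensionalityI[OF ext])
    show "to_kantor \<in> extensional V" by (simp add: to_kantor_def)
    fix x assume x: "x \<in> V"
    obtain a v where "a \<in> even_part" "x = a + e v" using V_cases[OF x] .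
    then show "\<psi> x = to_kantor x" by (simp add: add even_V to_kantor_add e even)
  qed
qed (simp_all add: graded_isomorphism_to_kantor to_kantor_em to_kantor_ep)

end

section \<open>Centroids\<close>

context five_graded
begin

lemma centroidD:
  assumes "f \<in> lie_centroid L"
  shows "f \<in> extensional V" "x \<in> V \<Longrightarrow> f x \<in> V"
    "x \<in> V \<Longrightarrow> y \<in> V \<Longrightarrow> f (x + y) = f x + f y" "x \<in> V \<Longrightarrow> f (sc a x) = sc a (f x)"
    "x \<in> V \<Longrightarrow> y \<in> V \<Longrightarrow> f (br x y) = br x (f y)" "x \<in> V \<Longrightarrow> y \<in> V \<Longrightarrow> f (br x y) = br (f x) y"
  using assms unfolding lie_centroid_def linear_between_def by blast+

text \<open>The degree \<open>d\<close> part of \<open>f\<close> again lies in the centroid, hence its kernel is an ideal; for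
  \<open>d \<noteq> 0\<close> it is nilpotent, so by simplicity it vanishes.\<close>

lemma centroid_degree:
  assumes simple: "simple_lie L" and f: "f \<in> lie_centroid L" and x: "x \<in> G i"
  shows "f x \<in> G i"
proof -
  note fD = centroidD[OF f]
  have f0: "f 0 = 0" using fD(4)[of 0 0] by simp
  have shift: "p (j + d) (f x) = 0" if x: "x \<in> G j" and d: "d \<noteq> 0" for d j x
  proof -
    \<comment> \<open>The kernel of the degree d part of f; the degree d part sends each component p
      i x to p (i + d) (f (p i x)).\<close>
    define K where "K = {x \<in> V. \<forall>i. p (i + d) (f (p i x)) = 0}"
    have subK: "N.subspace K"
      by (auto simp: N.subspace_def K_def f0 p_add p_scale fD)
    have hom: "br y x \<in> K" if "y \<in> G k" "x \<in> K" for k x y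
    proof -
      have x: "x \<in> V" and y: "y \<in> V" using that G_subset by (simp_all add: K_def)
      have "p (i + d) (f (p i (br y x))) = 0" for i
      proof -
        have "f (p i (br y x)) = br y (f (p (i - k) x))"
          using x y by (simp add: p_br_hom[OF that(1)] fD(5))
        then have "p (i + d) (f (p i (br y x))) = br y (p (i - k + d) (f (p (i - k) x)))"
          using x by (simp add: p_br_hom[OF that(1)] fD(2) algebra_simps)
        then show ?thesis using that(2) y by (simp add: K_def)
      qed
      then show ?thesis using x y by (simp add: K_def)
    qed
    have "br y x \<in> K" if y: "y \<in> V" and x: "x \<in> K" for x y
    proof -
      have xV: "x \<in> V" using x by (simp add: K_def)
      have "br y x = five_sum (\<lambda>k. br (p k y) x)"
        using y xV by (subst p_sum[OF y, symmetric]) (simp only: br_add p_V V_closed)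
      also have "\<dots> \<in> K"
        by (intro N.subspace_add[OF subK] hom[OF p_in[OF y] x])
      finally show ?thesis .
    qed
    moreover have "K \<subseteq> V" by (auto simp: K_def)
    ultimately have "lie_ideal L K" unfolding lie_ideal_def using subK by blast
    then have "K = {0} \<or> K = V" using simple unfolding simple_lie_def by blast
    then consider "K = {0}" | "K = V" by blast
    then show ?thesis
    proof cases
      case 1
      \<comment> \<open>With zero kernel the degree d part is injective, so a nonzero element in
        degree j produces one in degree j + d.\<close>
      have step: "\<exists>x\<in>G (j + d). x \<noteq> 0" if ex: "\<exists>x\<in>G j. x \<noteq> 0" for j
      proof -
        obtain x where x: "x \<in> G j" "x \<noteq> 0" using ex by blast
        have "p (j + d) (f x) \<noteq> 0"
        proof
          assume "p (j + d) (f x) = 0"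
          then have "x \<in> K" using p_hom[OF x(1)] G_subset[OF x(1)] f0 by (simp add: K_def)
          then show False using 1 x(2) by simp
        qed
        then show ?thesis using p_in[OF fD(2)[OF G_subset[OF x(1)]]] by blast
      qed
      obtain z where z: "z \<in> V" "z \<noteq> 0" using simple by (auto simp: simple_lie_def)
      then obtain k where k: "p k z \<noteq> 0" using p_eqI[OF z(1), of 0] by auto
      then have "\<bar>k\<bar> \<le> 2" using z(1) p_outside[of z k] by linarith
      moreover have "\<exists>x\<in>G k. x \<noteq> 0" using k z(1) by blast
      \<comment> \<open>Five steps suffice: the degree changes by 5d, at least 5 in absolute value,
        whereas two degrees in -2..2 differ by at most 4.\<close>
      from this[THEN step, THEN step, THEN step, THEN step, THEN step]
      obtain x where "x \<in> G (k + d + d + d + d + d)" "x \<noteq> 0" by blast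
      then have "\<bar>k + d + d + d + d + d\<bar> \<le> 2" using G_zero by (meson not_le)
      ultimately show ?thesis using d by linarith
    next
      case 2
      then have "x \<in> K" using G_subset[OF x] by simp
      then have "p (j + d) (f (p j x)) = 0" by (simp add: K_def)
      then show ?thesis by (simp add: p_hom[OF x])
    qed
  qed
  have fx: "f x \<in> V" using fD(2) G_subset[OF x] .
  have "f x = p i (f x)"
  proof (rule p_eqI)
    fix j
    show "p j (f x) = p j (p i (f x))"
      using shift[OF x, of "j - i"] fx by (simp add: p_p)
  qed (use fx in simp_all)
  then show ?thesis using p_in[OF fx, of i] by simp
qed

end

context tight_enveloping
begin

text \<open>The inverses are meaningful only when f preserves degrees -1 and 1, which
  \<open>centroid_degree\<close> provides for simple L.\<close>

definition restrict_centroid :: "('l \<Rightarrow> 'l) \<Rightarrow> ('m \<Rightarrow> 'm) \<times> ('p \<Rightarrow> 'p)" where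
  "restrict_centroid f = (\<lambda>x. inv em (f (em x)), \<lambda>x. inv ep (f (ep x)))"

lemma inv_em [simp]: "inv em (em x) = x" and inv_ep [simp]: "inv ep (ep y) = y"
  by (simp_all add: inv_f_f inj_def)

lemma restrict_centroid_apply:
  assumes "simple_lie L" "f \<in> lie_centroid L"
  shows "em (fst (restrict_centroid f) x) = f (em x)" "ep (snd (restrict_centroid f) y) = f (ep y)"
  using centroid_degree[OF assms em_G[of x]] centroid_degree[OF assms ep_G[of y]]
  by (auto simp: restrict_centroid_def elim: G_m1E G_1E)

lemma restrict_centroid_in:
  assumes simple: "simple_lie L" and f: "f \<in> lie_centroid L"
  shows "restrict_centroid f \<in> pair_centroid P"
proof -
  obtain \<omega> \<omega>' where \<omega>: "restrict_centroid f = (\<omega>, \<omega>')" by (cases "restrict_centroid f")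
  have em: "em (\<omega> x) = f (em x)" and ep: "ep (\<omega>' y) = f (ep y)" for x y
    using restrict_centroid_apply[OF assms] by (simp_all add: \<omega>)
  note fD = centroidD[OF f]
  have "module_hom sm sm \<omega>"
  proof unfold_locales
    fix x y a
    have "em (\<omega> (x + y)) = em (\<omega> x + \<omega> y)" by (simp add: em em_simps fD)
    then show "\<omega> (x + y) = \<omega> x + \<omega> y" by simp
    have "em (\<omega> (sm a x)) = em (sm a (\<omega> x))" by (simp add: em em_simps fD)
    then show "\<omega> (sm a x) = sm a (\<omega> x)" by simp
  qed
  moreover have "module_hom sp sp \<omega>'"
  proof unfold_locales
    fix x y a
    have "ep (\<omega>' (x + y)) = ep (\<omega>' x + \<omega>' y)" by (simp add: ep ep_simps fD)
    then show "\<omega>' (x + y) = \<omega>' x + \<omega>' y" by simp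
    have "ep (\<omega>' (sp a x)) = ep (sp a (\<omega>' x))" by (simp add: ep ep_simps fD)
    then show "\<omega>' (sp a x) = sp a (\<omega>' x)" by simp
  qed
  moreover have "centralizes tm \<omega> \<omega>'"
    unfolding centralizes_def
  proof (intro allI)
    fix x y z
    have 1: "f (br (br (em x) (ep y)) (em z)) = br (br (f (em x)) (ep y)) (em z)"
      using fD(6)[of "br (em x) (ep y)" "em z"] fD(6)[of "em x" "ep y"] by simp
    have 2: "f (br (br (em x) (ep y)) (em z)) = br (br (em x) (f (ep y))) (em z)"
      using fD(6)[of "br (em x) (ep y)" "em z"] fD(5)[of "em x" "ep y"] by simp
    have 3: "f (br (br (em x) (ep y)) (em z)) = br (br (em x) (ep y)) (f (em z))"
      using fD(5)[of "br (em x) (ep y)" "em z"] by simp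
    have "em (\<omega> (tm x y z)) = em (tm (\<omega> x) y z)" "em (\<omega> (tm x y z)) = em (tm x (\<omega>' y) z)"
      "em (\<omega> (tm x y z)) = em (tm x y (\<omega> z))"
      unfolding em_triple em ep by (rule 1 2 3)+
    then show "\<omega> (tm x y z) = tm (\<omega> x) y z \<and> \<omega> (tm x y z) = tm x (\<omega>' y) z \<and> \<omega> (tm x y z) = tm x y (\<omega> z)"
      by simp
  qed
  moreover have "centralizes tp \<omega>' \<omega>"
    unfolding centralizes_def
  proof (intro allI)
    fix x y z
    have 1: "f (br (br (ep x) (em y)) (ep z)) = br (br (f (ep x)) (em y)) (ep z)"
      using fD(6)[of "br (ep x) (em y)" "ep z"] fD(6)[of "ep x" "em y"] by simp
    have 2: "f (br (br (ep x) (em y)) (ep z)) = br (br (ep x) (f (em y))) (ep z)"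
      using fD(6)[of "br (ep x) (em y)" "ep z"] fD(5)[of "ep x" "em y"] by simp
    have 3: "f (br (br (ep x) (em y)) (ep z)) = br (br (ep x) (em y)) (f (ep z))"
      using fD(5)[of "br (ep x) (em y)" "ep z"] by simp
    have "ep (\<omega>' (tp x y z)) = ep (tp (\<omega>' x) y z)" "ep (\<omega>' (tp x y z)) = ep (tp x (\<omega> y) z)"
      "ep (\<omega>' (tp x y z)) = ep (tp x y (\<omega>' z))"
      unfolding ep_triple em ep by (rule 1 2 3)+
    then show "\<omega>' (tp x y z) = tp (\<omega>' x) y z \<and> \<omega>' (tp x y z) = tp x (\<omega> y) z \<and> \<omega>' (tp x y z) = tp x y (\<omega>' z)"
      by simp
  qed
  ultimately show ?thesis by (simp add: pair_centroid_def \<omega>)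
qed

lemma restrict_centroid_inj:
  assumes simple: "simple_lie L"
  shows "inj_on restrict_centroid (lie_centroid L)"
proof (rule inj_onI)
  fix f g assume f: "f \<in> lie_centroid L" and g: "g \<in> lie_centroid L"
    and eq: "restrict_centroid f = restrict_centroid g"
  note fD = centroidD[OF f] and gD = centroidD[OF g]
  have e: "f (e v) = g (e v)" for v
    using restrict_centroid_apply[OF simple f] restrict_centroid_apply[OF simple g] eq
    by (simp add: e_def fD gD)
  have even: "f a = g a" if "a \<in> even_part" for a
    using that
  proof (induct rule: even_induct)
    case (br_e x y)
    show ?case by (simp add: fD(5) gD(5) e)
  next
    case zero
    show ?case using e[of 0] by simp
  qed (simp_all add: fD gD even_V)
  show "f = g"
  proof (rule extensionalityI[OF fD(1) gD(1)])
    fix x assume x: "x \<in> V"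
    obtain a v where "a \<in> even_part" "x = a + e v" using V_cases[OF x] .
    then show "f x = g x" by (simp add: fD gD even_V e even)
  qed
qed

text \<open>An extension f of \<omega> must satisfy [f a, v] = [a, f v] for even a and v in T. By
  faithfulness this prescribes f a uniquely; what has to be shown is that an even element with this
  action exists.\<close>

lemma restrict_centroid_surj:
  assumes "\<omega> \<in> pair_centroid P"
  shows "\<exists>f\<in>lie_centroid L. restrict_centroid f = \<omega>"
proof -
  obtain \<omega>m \<omega>p where \<omega>: "\<omega> = (\<omega>m, \<omega>p)" by (cases \<omega>)
  have hom: "module_hom sm sm \<omega>m" "module_hom sp sp \<omega>p"
    and cen: "centralizes tm \<omega>m \<omega>p" "centralizes tp \<omega>p \<omega>m"
    using assms by (simp_all add: pair_centroid_def \<omega>)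
  note \<omega>_simps = hom[THEN module_hom.add] hom[THEN module_hom.diff] hom[THEN module_hom.scale]
    hom[THEN module_hom.zero]
  define om where "om v = (\<omega>m (fst v), \<omega>p (snd v))" for v
  have om_add: "om (v + w) = om v + om w" and om_diff: "om (v - w) = om v - om w"
    and om_scale: "om (col c v) = col c (om v)" and om_zero: "om 0 = 0" for v w c
    by (simp_all add: om_def \<omega>_simps smult_column_def split_beta prod_eq_iff)
  have om_cb: "om (cb x y z) = cb (om x) y z" "om (cb x y z) = cb x (om y) z" "om (cb x y z) = cb x y (om z)" for x y z
  proof -
    have m: "\<omega>m (tm x y z) = tm (\<omega>m x) y z" "tm x (\<omega>p y) z = tm (\<omega>m x) y z" "tm x y (\<omega>m z) = tm (\<omega>m x) y z" for x y z
      using cen(1) unfolding centralizes_def by metis+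
    have p: "\<omega>p (tp x y z) = tp (\<omega>p x) y z" "tp x (\<omega>m y) z = tp (\<omega>p x) y z" "tp x y (\<omega>p z) = tp (\<omega>p x) y z" for x y z
      using cen(2) unfolding centralizes_def by metis+
    show "om (cb x y z) = cb (om x) y z" "om (cb x y z) = cb x (om y) z" "om (cb x y z) = cb x y (om z)"
      by (simp_all add: om_def cb_eq \<omega>_simps m p)
  qed
  have om_act: "act a (om v) = om (act a v)" if "a \<in> even_part" for a v
    using that
  proof (induct rule: even_induct)
    case (br_e x y)
    show ?case using om_cb(3) by simp
  qed (simp_all add: act_add act_scale act_zero om_add om_scale om_zero)
  \<comment> \<open>For a = [e x, e y] the element [e x, e (om y)] works, because \<omega> can be
    moved from the third argument of \<open>cb\<close> to the second.\<close>
  have "\<exists>a'\<in>even_part. \<forall>v. act a' v = act a (om v)" if "a \<in> even_part" for a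
    using that
  proof (induct rule: even_induct)
    case (br_e x y)
    have "act (br (e x) (e (om y))) v = act (br (e x) (e y)) (om v)" for v
      using om_cb(2,3) by (metis act_br_e)
    then show ?case using br_e_even by blast
  next
    case zero
    show ?case by (intro bexI[of _ 0] allI) (simp_all add: act_zero N.subspace_0[OF subspace_even])
  next
    case (add a b)
    then obtain a' b' where "a' \<in> even_part" "\<And>v. act a' v = act a (om v)"
      "b' \<in> even_part" "\<And>v. act b' v = act b (om v)" by blast
    then show ?case
      using add(1,2) N.subspace_add[OF subspace_even, of a' b'] by (intro bexI[of _ "a' + b'"]) (simp_all add: act_add)
  next
    case (scale c a)
    then obtain a' where "a' \<in> even_part" "\<And>v. act a' v = act a (om v)" by blast
    then show ?case
      using scale(1) N.subspace_scale[OF subspace_even, of a' c] by (intro bexI[of _ "sc c a'"]) (simp_all add: act_scale)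
  qed
  \<comment> \<open>Although t is merely chosen pointwise, its values are determined by their
    action, so it is linear by \<open>act_faithful\<close>.\<close>
  then obtain t where t: "\<And>a. a \<in> even_part \<Longrightarrow> t a \<in> even_part" "\<And>a v. a \<in> even_part \<Longrightarrow> act (t a) v = act a (om v)"
    by metis
  note even_closed = N.subspace_0[OF subspace_even] N.subspace_add[OF subspace_even] N.subspace_scale[OF subspace_even]
  have t_add: "t (a + b) = t a + t b" if "a \<in> even_part" "b \<in> even_part" for a b
    using that by (intro act_faithful) (simp_all add: t act_add even_closed)
  have t_scale: "t (sc c a) = sc c (t a)" if "a \<in> even_part" for a c
    using that by (intro act_faithful) (simp_all add: t act_scale even_closed)
  have t_zero: "t 0 = 0"
    by (intro act_faithful) (simp_all add: t act_zero even_closed)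
  define f where "f = (\<lambda>x\<in>V. t (even_of x) + e (om (inv e (odd_of x))))"
  have f_sum: "f (a + e v) = t a + e (om v)" if "a \<in> even_part" for a v
    using that by (simp add: f_def even_V even_of_linear odd_of_linear even_of_even odd_of_odd)
  have f_V: "f x \<in> V" if x: "x \<in> V" for x
    using x even_V[OF t(1)[OF even_of_in[OF x]]] by (simp add: f_def)
  have f_add: "f (x + y) = f x + f y" if x: "x \<in> V" and y: "y \<in> V" for x y
  proof -
    obtain a v where av: "a \<in> even_part" "x = a + e v" using V_cases[OF x] .
    obtain b w where bw: "b \<in> even_part" "y = b + e w" using V_cases[OF y] .
    have "x + y = (a + b) + e (v + w)" by (simp add: av bw e_add)
    then have "f (x + y) = t (a + b) + e (om (v + w))"
      using f_sum[OF even_closed(2)[OF av(1) bw(1)]] by (simp only:)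
    moreover have "f x = t a + e (om v)" "f y = t b + e (om w)"
      using av bw by (simp_all add: f_sum)
    ultimately show ?thesis using av(1) bw(1) by (simp add: t_add om_add e_add)
  qed
  have f_scale: "f (sc c x) = sc c (f x)" if x: "x \<in> V" for c x
  proof -
    obtain a v where av: "a \<in> even_part" "x = a + e v" using V_cases[OF x] .
    have "sc c x = sc c a + e (col c v)" by (simp add: av e_scale N.scale_right_distrib)
    then have "f (sc c x) = t (sc c a) + e (om (col c v))"
      using f_sum[OF even_closed(3)[OF av(1)]] by (simp only:)
    moreover have "f x = t a + e (om v)" using av by (simp add: f_sum)
    ultimately show ?thesis
      using av(1) by (simp add: t_scale om_scale e_scale N.scale_right_distrib)
  qed
  have f_br: "f (br x y) = br x (f y)" if x: "x \<in> V" and y: "y \<in> V" for x y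
  proof -
    obtain a v where av: "a \<in> even_part" "x = a + e v" using V_cases[OF x] .
    obtain b w where bw: "b \<in> even_part" "y = b + e w" using V_cases[OF y] .
    \<comment> \<open>Both sides are even, so only their actions need comparing. They agree because
      \<open>om\<close> commutes with every \<open>act a\<close> and can be moved between the
      arguments of \<open>cb\<close>.\<close>
    have "t (br a b + br (e v) (e w)) = br a (t b) + br (e v) (e (om w))"
    proof (rule act_faithful)
      show "t (br a b + br (e v) (e w)) \<in> even_part" using br_sum(2) av(1) bw(1) t by blast
      show "br a (t b) + br (e v) (e (om w)) \<in> even_part" using br_sum(2) av(1) t(1)[OF bw(1)] by blast
      show "act (t (br a b + br (e v) (e w))) u = act (br a (t b) + br (e v) (e (om w))) u" for u
        using av(1) bw(1) t(1)[OF bw(1)] om_cb(3)[of v w u] om_cb(2)[of v w u]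
        by (simp add: t even_closed even_even act_add act_br om_act om_add om_diff)
    qed
    moreover have "f (br x y) = t (br a b + br (e v) (e w)) + e (om (act a w - act b v))"
      unfolding av(2) bw(2) br_sum(1)[OF av(1) bw(1)] by (rule f_sum[OF br_sum(2)[OF av(1) bw(1)]])
    moreover have "br x (f y) = (br a (t b) + br (e v) (e (om w))) + e (act a (om w) - act (t b) v)"
      unfolding av(2) bw(2) f_sum[OF bw(1)] by (rule br_sum(1)[OF av(1) t(1)[OF bw(1)]])
    ultimately show ?thesis using av(1) bw(1) by (simp add: om_diff om_act t)
  qed
  have f_br': "f (br x y) = br (f x) y" if x: "x \<in> V" and y: "y \<in> V" for x y
  proof -
    have "f (br x y) = f (- br y x)" using br_anti[OF x y] by simp
    also have "\<dots> = - br y (f x)"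
      using f_scale[of "br y x" "- 1"] x y by (simp add: f_br)
    finally show ?thesis using br_anti[OF f_V[OF x] y] by simp
  qed
  have "f \<in> lie_centroid L"
    using f_V f_add f_scale f_br f_br' by (simp add: lie_centroid_def linear_between_def) (simp add: f_def)
  moreover have "restrict_centroid f = \<omega>"
  proof -
    have "f (em x) = em (\<omega>m x)" "f (ep y) = ep (\<omega>p y)" for x y
      using f_sum[OF even_closed(1), of "(x, 0)"] f_sum[OF even_closed(1), of "(0, y)"]
      by (simp_all add: e_def om_def t_zero em_simps ep_simps \<omega>_simps)
    then show ?thesis by (simp add: restrict_centroid_def \<omega>)
  qed
  ultimately show ?thesis by blast
qed

text \<open>Restriction is a bijection of centroids that carries multiplication by a scalar on L to
  multiplication by the same scalar on P. So the scalars fill one centroid bijectively iff they fill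
  the other.\<close>

lemma central_lie_iff_central_pair:
  assumes simple: "simple_lie L"
  shows "central_lie L \<longleftrightarrow> central_pair P"
proof -
  have bij: "bij_betw restrict_centroid (lie_centroid L) (pair_centroid P)"
  proof (rule bij_betw_imageI[OF restrict_centroid_inj[OF simple]], rule subset_antisym)
    show "restrict_centroid ` lie_centroid L \<subseteq> pair_centroid P"
      using restrict_centroid_in[OF simple] by (rule image_subsetI)
    show "pair_centroid P \<subseteq> restrict_centroid ` lie_centroid L"
      using restrict_centroid_surj by (metis imageI subsetI)
  qed
  have "(\<lambda>x\<in>V. sc a x) \<in> lie_centroid L" for a
    by (auto simp: lie_centroid_def linear_between_def br_scale N.scale_right_distrib mult.commute)
  then have sub: "(\<lambda>a. \<lambda>x\<in>V. sc a x) ` UNIV \<subseteq> lie_centroid L" by blast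
  have "restrict_centroid (\<lambda>x\<in>V. sc a x) = (\<lambda>x. sm a x, \<lambda>x. sp a x)" for a
    by (simp add: restrict_centroid_def flip: em_simps(2) ep_simps(2))
  then have "restrict_centroid \<circ> (\<lambda>a. \<lambda>x\<in>V. sc a x) = (\<lambda>a. (\<lambda>x. sm a x, \<lambda>x. sp a x))"
    by (simp add: fun_eq_iff)
  then show ?thesis
    using bij_betw_comp_iff2[OF bij sub] by (simp add: central_lie_def central_pair_def)
qed

end

section \<open>Assembling the three claims\<close>

lemma simple_envelope_tight:
  assumes "kantor_pair P" "nonzero_pair P"
    and "five_graded_lie_algebra L \<and> simple_lie L \<and> envelops L P em ep"
  shows "tight_enveloping L P em ep"
proof -
  interpret enveloping L P em ep using assms by unfold_locales blast+
  show ?thesis using simple_imp_tight assms by blast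
qed

theorem theorem3p5p5:
  fixes P :: "('k::comm_ring_1, 'm::ab_group_add, 'p::ab_group_add) pair"
  assumes "\<exists>c::'k. 6 * c = 1"
    and "kantor_pair P"
    and "nonzero_pair P"
  shows
    "\<comment> \<open>(i)\<close>
     (simple_pair P \<longleftrightarrow>
        (\<exists>(L :: ('k, ('m, 'p) kantor_space) graded_lie) em ep.
           five_graded_lie_algebra L \<and> simple_lie L \<and> envelops L P em ep)) \<and>
     (\<forall>(L :: ('k, 'l::ab_group_add) graded_lie) em ep.
        five_graded_lie_algebra L \<and> simple_lie L \<and> envelops L P em ep \<longrightarrow> simple_pair P) \<and>
     \<comment> \<open>(ii)\<close>
     (\<forall>(L :: ('k, 'l) graded_lie) em ep.
        five_graded_lie_algebra L \<and> simple_lie L \<and> envelops L P em ep \<longrightarrow>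
        (\<exists>!\<phi>. \<phi> \<in> extensional (carrier L) \<and> graded_isomorphism L (kantor_lie P) \<phi> \<and>
              (\<forall>x. \<phi> (em x) = kantor_minus x) \<and> (\<forall>x. \<phi> (ep x) = kantor_plus x))) \<and>
     \<comment> \<open>(iii)\<close>
     (simple_pair P \<and> central_pair P \<longleftrightarrow>
        (\<exists>(L :: ('k, ('m, 'p) kantor_space) graded_lie) em ep.
           five_graded_lie_algebra L \<and> simple_lie L \<and> central_lie L \<and> envelops L P em ep)) \<and>
     (\<forall>(L :: ('k, 'l) graded_lie) em ep.
        five_graded_lie_algebra L \<and> simple_lie L \<and> central_lie L \<and> envelops L P em ep \<longrightarrow>
        simple_pair P \<and> central_pair P)"
proof -
  interpret kantor_pair_loc P using assms(2) by unfold_locales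
  interpret K: tight_enveloping "kantor_lie P" P kantor_minus kantor_plus
    by (rule tight_enveloping_kantor)
  note tight = simple_envelope_tight[OF assms(2,3)]
  note K_envelope = five_graded_kantor envelops_kantor K.simple_pair_imp_simple_lie
  \<comment> \<open>Each transfer is needed at two carrier types: the existential claims are
    witnessed by \<open>kantor_lie P\<close> inside \<open>kantor_space\<close>, while the universal
    ones concern an arbitrary type \<open>'l\<close>.\<close>
  have simple: "simple_pair P"
    if "five_graded_lie_algebra L \<and> simple_lie L \<and> envelops L P em ep"
    for L :: "('k, ('m, 'p) kantor_space) graded_lie" and em ep
    using tight_enveloping.simple_lie_imp_simple_pair[OF tight[OF that]] that by blast
  have simple': "simple_pair P"
    if "five_graded_lie_algebra L \<and> simple_lie L \<and> envelops L P em ep"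
    for L :: "('k, 'l) graded_lie" and em ep
    using tight_enveloping.simple_lie_imp_simple_pair[OF tight[OF that]] that by blast
  have central: "central_lie L \<longleftrightarrow> central_pair P"
    if "five_graded_lie_algebra L \<and> simple_lie L \<and> envelops L P em ep"
    for L :: "('k, ('m, 'p) kantor_space) graded_lie" and em ep
    using tight_enveloping.central_lie_iff_central_pair[OF tight[OF that]] that by blast
  have central': "central_lie L \<longleftrightarrow> central_pair P"
    if "five_graded_lie_algebra L \<and> simple_lie L \<and> envelops L P em ep"
    for L :: "('k, 'l) graded_lie" and em ep
    using tight_enveloping.central_lie_iff_central_pair[OF tight[OF that]] that by blast
  show ?thesis
  proof (intro conjI)
    show "simple_pair P \<longleftrightarrow>
        (\<exists>(L :: ('k, ('m, 'p) kantor_space) graded_lie) em ep.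
           five_graded_lie_algebra L \<and> simple_lie L \<and> envelops L P em ep)"
      using simple K_envelope by meson
    show "\<forall>(L :: ('k, 'l) graded_lie) em ep.
        five_graded_lie_algebra L \<and> simple_lie L \<and> envelops L P em ep \<longrightarrow> simple_pair P"
      using simple' by blast
    show "\<forall>(L :: ('k, 'l) graded_lie) em ep.
        five_graded_lie_algebra L \<and> simple_lie L \<and> envelops L P em ep \<longrightarrow>
        (\<exists>!\<phi>. \<phi> \<in> extensional (carrier L) \<and> graded_isomorphism L (kantor_lie P) \<phi> \<and>
              (\<forall>x. \<phi> (em x) = kantor_minus x) \<and> (\<forall>x. \<phi> (ep x) = kantor_plus x))"
      by (intro allI impI) (rule tight_enveloping.unique_isomorphism[OF tight])
    show "simple_pair P \<and> central_pair P \<longleftrightarrow>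
        (\<exists>(L :: ('k, ('m, 'p) kantor_space) graded_lie) em ep.
           five_graded_lie_algebra L \<and> simple_lie L \<and> central_lie L \<and> envelops L P em ep)"
      using simple central K_envelope by meson
    show "\<forall>(L :: ('k, 'l) graded_lie) em ep.
        five_graded_lie_algebra L \<and> simple_lie L \<and> central_lie L \<and> envelops L P em ep \<longrightarrow>
        simple_pair P \<and> central_pair P"
      using simple' central' by blast
  qed
qed

end
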